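(* Let $n\in\mathbb{N}$, $a<b$, $A\in L_\infty^{n\times3n}[a,b]$, and let $B\in\mathbb{R}^{2n\times4n}$ be such that the $2n\times2n$ matrix $BH$ is invertible. Let $\mathcal{T}_1,\mathcal{A}_{11}$ be the operators defined in the context. Then, for any given input $\mathbf{p}(t)\in L_2^n[a,b]$: (1) $\mathbf{v}$ is a solution to the PIE $$\mathcal{T}_1\mathbf{v}_t(t)=\mathcal{A}_{11}\mathbf{v}(t)+\mathbf{p}(t),\qquad\mathbf{v}(t)\in L_2^n[a,b],$$ with initial state $\mathbf{v}_0\in L_2^n[a,b]$ if and only if $\mathbf{u}=\mathcal{T}_1\mathbf{v}$ is a solution to the PDE $$\mathbf{u}_t(t)=A\begin{bmatrix}\mathbf{u}(t)\\ \mathbf{u}_x(t)\\ \mathbf{u}_{xx}(t)\end{bmatrix}+\mathbf{p}(t),\qquad\mathbf{u}(t)\in X_B,$$ with initial state $\mathbf{u}_0=\mathcal{T}_1\mathbf{v}_0$. (2) Conversely, $\mathbf{u}$ is a solution to this PDE with initial state $\mathbf{u}_0\in X_B$ if and only if $\mathbf{v}=\partial_x^2\mathbf{u}$ is a solution to this PIE with initial state $\mathbf{v}_0=\partial_x^2\mathbf{u}_0$.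
   Context: $H_2^n[a,b]$ is the set of $\mathbf{u}$ with $\mathbf{u},\mathbf{u}_x,\mathbf{u}_{xx}\in L_2^n[a,b]$, and $X_B=\{\mathbf{u}\in H_2^n[a,b]: B\,(\mathbf{u}(a),\mathbf{u}(b),\mathbf{u}_x(a),\mathbf{u}_x(b))^T=0\}$. Let $$H=\begin{bmatrix} I_n & 0\\ I_n & (b-a) I_n\\ 0 & I_n\\ 0 & I_n\end{bmatrix},\quad Q(x,\theta)=\begin{bmatrix} 0\\ (b-\theta) I_n\\ 0\\ I_n\end{bmatrix},\quad K(x)=\begin{bmatrix} I_n & (x-a) I_n\end{bmatrix},$$ $$T_2(x,\theta)=-K(x)(BH)^{-1}BQ(x,\theta),\qquad T_1(x,\theta)=(x-\theta)I_n+T_2(x,\theta),$$ $$(\mathcal{T}_1\mathbf{v})(x)=\int_a^xT_1(x,\theta)\mathbf{v}(\theta)d\theta+\int_x^bT_2(x,\theta)\mathbf{v}(\theta)d\theta,$$ $$(\mathcal{A}_{11}\mathbf{v})(x)=A_0(x)\mathbf{v}(x)+\int_a^xA_1(x,\theta)\mathbf{v}(\theta)d\theta+\int_x^bA_2(x,\theta)\mathbf{v}(\theta)d\theta,$$ where $A_0(x)=A(x)\begin{bmatrix} 0\\ 0\\ I_n\end{bmatrix}$ and $A_j(x,\theta)=A(x)\begin{bmatrix}T_j(x,\theta)\\ \partial_xT_j(x,\theta)\\ 0\end{bmatrix}$ for $j=1,2$. A solution of the PIE (partial integral equation), respectively of the PDE, with a given initial state is a Fréchet differentiable function of $t$ that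 equals the initial state at $t=0$ and satisfies the stated equation and membership condition for all $t\ge0$.
   Formalization: In part (2) u(t) is assumed to lie in X_B for all t≥0: otherwise adding to u(t) a function affine in x leaves ∂_x²u unchanged but breaks the boundary conditions. Differentiability in t of u is taken in the H_2 norm, that of v in L_2. *)

theory Defs
  imports "HOL-Analysis.Analysis"
begin

text \<open>
  Elements of the function spaces on \<open>[a,b]\<close> are represented by functions on \<open>real\<close>. Only their
  values almost everywhere on \<open>[a,b]\<close> matter: all notions below respect equality almost everywhere
  on \<open>[a,b]\<close>, and equality of elements is stated as \<open>ae_eq\<close>.
\<close>

section \<open>Lebesgue spaces\<close>

definition ae_eq :: "real \<Rightarrow> real \<Rightarrow> (real \<Rightarrow> 'c) \<Rightarrow> (real \<Rightarrow> 'c) \<Rightarrow> bool" where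
  "ae_eq a b f g \<longleftrightarrow> (AE x in lebesgue_on {a..b}. f x = g x)"

definition L2 :: "real \<Rightarrow> real \<Rightarrow> (real \<Rightarrow> 'c::euclidean_space) set" where
  "L2 a b = {f \<in> borel_measurable (lebesgue_on {a..b}).
               integrable (lebesgue_on {a..b}) (\<lambda>x. (norm (f x))\<^sup>2)}"

definition L2_norm :: "real \<Rightarrow> real \<Rightarrow> (real \<Rightarrow> 'c::euclidean_space) \<Rightarrow> real" where
  "L2_norm a b f = sqrt (\<integral>x. (norm (f x))\<^sup>2 \<partial>lebesgue_on {a..b})"

definition Linf :: "real \<Rightarrow> real \<Rightarrow> (real \<Rightarrow> 'c::euclidean_space) set" where
  "Linf a b = {f \<in> borel_measurable (lebesgue_on {a..b}).
                 \<exists>C. AE x in lebesgue_on {a..b}. norm (f x) \<le> C}"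

section \<open>Weak derivatives and the space \<open>H\<^sub>2\<close>\<close>

definition test_function :: "real \<Rightarrow> real \<Rightarrow> (real \<Rightarrow> real) \<Rightarrow> bool" where
  "test_function a b \<phi> \<longleftrightarrow> \<phi> C1_differentiable_on UNIV \<and>
     (\<exists>S. compact S \<and> S \<subseteq> {a<..<b} \<and> (\<forall>x. x \<notin> S \<longrightarrow> \<phi> x = 0))"

text \<open>The weak derivative in one dimension, with continuously differentiable test functions of
  compact support in the open interval, as in Brezis, Functional Analysis, Sobolev Spaces and
  Partial Differential Equations, Section 8.2.\<close>

definition has_weak_deriv ::
  "real \<Rightarrow> real \<Rightarrow> (real \<Rightarrow> 'c::euclidean_space) \<Rightarrow> (real \<Rightarrow> 'c) \<Rightarrow> bool" where
  "has_weak_deriv a b u g \<longleftrightarrow> u \<in> L2 a b \<and> g \<in> L2 a b \<and>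
     (\<forall>\<phi>. test_function a b \<phi> \<longrightarrow>
        (\<integral>x. deriv \<phi> x *\<^sub>R u x \<partial>lebesgue_on {a..b}) = - (\<integral>x. \<phi> x *\<^sub>R g x \<partial>lebesgue_on {a..b}))"

text \<open>The weak derivative is unique up to \<open>ae_eq\<close>; \<open>dx\<close> picks one of its representatives.\<close>

definition dx :: "real \<Rightarrow> real \<Rightarrow> (real \<Rightarrow> 'c::euclidean_space) \<Rightarrow> (real \<Rightarrow> 'c)" where
  "dx a b u = (SOME g. has_weak_deriv a b u g)"

definition H2 :: "real \<Rightarrow> real \<Rightarrow> (real \<Rightarrow> 'c::euclidean_space) set" where
  "H2 a b = {u. \<exists>g h. has_weak_deriv a b u g \<and> has_weak_deriv a b g h}"

definition H2_norm :: "real \<Rightarrow> real \<Rightarrow> (real \<Rightarrow> 'c::euclidean_space) \<Rightarrow> real" where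
  "H2_norm a b u =
     sqrt ((L2_norm a b u)\<^sup>2 + (L2_norm a b (dx a b u))\<^sup>2 + (L2_norm a b (dx a b (dx a b u)))\<^sup>2)"

text \<open>Boundary values of \<open>u\<close> and \<open>u\<^sub>x\<close> are those of the continuous representative on the
  closed interval, whose values on \<open>[a,b]\<close> are uniquely determined when \<open>a < b\<close>.\<close>

definition cont_rep :: "real \<Rightarrow> real \<Rightarrow> (real \<Rightarrow> 'c::euclidean_space) \<Rightarrow> (real \<Rightarrow> 'c)" where
  "cont_rep a b f = (SOME g. continuous_on {a..b} g \<and> ae_eq a b g f)"

section \<open>Block matrices\<close>

text \<open>Block indices are sum types, so that \<open>\<real>\<^sup>2\<^sup>n\<close> is \<open>real ^ ('n + 'n)\<close>. As a matrix is a vector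
  of rows, \<open>vstack\<close> stacks column vectors as well as matrices.\<close>

definition vstack :: "'c ^ 'm \<Rightarrow> 'c ^ 'k \<Rightarrow> 'c ^ ('m::finite + 'k::finite)" (infixr "\<triangleright>" 65) where
  "M \<triangleright> N = (\<chi> i. case i of Inl j \<Rightarrow> M $ j | Inr j \<Rightarrow> N $ j)"

definition hstack :: "'c ^ 'm ^ 'r \<Rightarrow> 'c ^ 'k ^ 'r \<Rightarrow> 'c ^ ('m::finite + 'k::finite) ^ 'r" where
  "hstack M N = (\<chi> r. M $ r \<triangleright> N $ r)"

section \<open>The domain of the PDE and the operators of the PIE\<close>

definition X_B :: "real \<Rightarrow> real \<Rightarrow> real ^ ('n + 'n + 'n + 'n) ^ ('n + 'n)
    \<Rightarrow> (real \<Rightarrow> real ^ 'n::finite) set" where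
  "X_B a b B = {u \<in> H2 a b.
     B *v (cont_rep a b u a \<triangleright> cont_rep a b u b \<triangleright>
           cont_rep a b (dx a b u) a \<triangleright> cont_rep a b (dx a b u) b) = 0}"

definition Hmat :: "real \<Rightarrow> real \<Rightarrow> real ^ ('n + 'n) ^ ('n::finite + 'n + 'n + 'n)" where
  "Hmat a b = hstack (mat 1) 0 \<triangleright> hstack (mat 1) ((b - a) *\<^sub>R mat 1) \<triangleright>
              hstack 0 (mat 1) \<triangleright> hstack 0 (mat 1)"

definition Qmat :: "real \<Rightarrow> real \<Rightarrow> real ^ 'n ^ ('n::finite + 'n + 'n + 'n)" where
  "Qmat b \<theta> = 0 \<triangleright> (b - \<theta>) *\<^sub>R mat 1 \<triangleright> 0 \<triangleright> mat 1"

definition Kmat :: "real \<Rightarrow> real \<Rightarrow> real ^ ('n + 'n) ^ 'n::finite" where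
  "Kmat a x = hstack (mat 1) ((x - a) *\<^sub>R mat 1)"

definition T2 :: "real \<Rightarrow> real \<Rightarrow> real ^ ('n + 'n + 'n + 'n) ^ ('n + 'n)
    \<Rightarrow> real \<Rightarrow> real \<Rightarrow> real ^ 'n ^ 'n::finite" where
  "T2 a b B x \<theta> = - (Kmat a x ** matrix_inv (B ** Hmat a b) ** B ** Qmat b \<theta>)"

definition T1 :: "real \<Rightarrow> real \<Rightarrow> real ^ ('n + 'n + 'n + 'n) ^ ('n + 'n)
    \<Rightarrow> real \<Rightarrow> real \<Rightarrow> real ^ 'n ^ 'n::finite" where
  "T1 a b B x \<theta> = (x - \<theta>) *\<^sub>R mat 1 + T2 a b B x \<theta>"

definition T1_op :: "real \<Rightarrow> real \<Rightarrow> real ^ ('n + 'n + 'n + 'n) ^ ('n + 'n)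
    \<Rightarrow> (real \<Rightarrow> real ^ 'n) \<Rightarrow> (real \<Rightarrow> real ^ 'n::finite)" where
  "T1_op a b B v x =
     (\<integral>\<theta>. T1 a b B x \<theta> *v v \<theta> \<partial>lebesgue_on {a..x}) +
     (\<integral>\<theta>. T2 a b B x \<theta> *v v \<theta> \<partial>lebesgue_on {x..b})"

definition A0 :: "(real \<Rightarrow> real ^ ('n + 'n + 'n) ^ 'n) \<Rightarrow> real \<Rightarrow> real ^ 'n ^ 'n::finite" where
  "A0 A x = A x ** (0 \<triangleright> 0 \<triangleright> mat 1)"

definition A1 :: "real \<Rightarrow> real \<Rightarrow> (real \<Rightarrow> real ^ ('n + 'n + 'n) ^ 'n)
    \<Rightarrow> real ^ ('n + 'n + 'n + 'n) ^ ('n + 'n) \<Rightarrow> real \<Rightarrow> real \<Rightarrow> real ^ 'n ^ 'n::finite" where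
  "A1 a b A B x \<theta> =
     A x ** (T1 a b B x \<theta> \<triangleright> vector_derivative (\<lambda>y. T1 a b B y \<theta>) (at x) \<triangleright> 0)"

definition A2 :: "real \<Rightarrow> real \<Rightarrow> (real \<Rightarrow> real ^ ('n + 'n + 'n) ^ 'n)
    \<Rightarrow> real ^ ('n + 'n + 'n + 'n) ^ ('n + 'n) \<Rightarrow> real \<Rightarrow> real \<Rightarrow> real ^ 'n ^ 'n::finite" where
  "A2 a b A B x \<theta> =
     A x ** (T2 a b B x \<theta> \<triangleright> vector_derivative (\<lambda>y. T2 a b B y \<theta>) (at x) \<triangleright> 0)"

definition A11_op :: "real \<Rightarrow> real \<Rightarrow> (real \<Rightarrow> real ^ ('n + 'n + 'n) ^ 'n)
    \<Rightarrow> real ^ ('n + 'n + 'n + 'n) ^ ('n + 'n)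
    \<Rightarrow> (real \<Rightarrow> real ^ 'n) \<Rightarrow> (real \<Rightarrow> real ^ 'n::finite)" where
  "A11_op a b A B v x = A0 A x *v v x +
     (\<integral>\<theta>. A1 a b A B x \<theta> *v v \<theta> \<partial>lebesgue_on {a..x}) +
     (\<integral>\<theta>. A2 a b A B x \<theta> *v v \<theta> \<partial>lebesgue_on {x..b})"

section \<open>Solutions\<close>

text \<open>The Frechet derivative at \<open>t\<close> of a curve \<open>f\<close> on \<open>[0,\<infinity>)\<close> in the function space \<open>X\<close> with
  (semi)norm \<open>N\<close>; it is one-sided at \<open>0\<close>, and \<open>d\<close> stands for the linear map \<open>h \<mapsto> h d\<close>.\<close>

definition has_frechet_deriv :: "(real \<Rightarrow> 'c::real_normed_vector) set \<Rightarrow> ((real \<Rightarrow> 'c) \<Rightarrow> real)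
    \<Rightarrow> (real \<Rightarrow> real \<Rightarrow> 'c) \<Rightarrow> (real \<Rightarrow> 'c) \<Rightarrow> real \<Rightarrow> bool" where
  "has_frechet_deriv X N f d t \<longleftrightarrow> d \<in> X \<and>
     ((\<lambda>s. N (\<lambda>x. f s x - f t x - (s - t) *\<^sub>R d x) / \<bar>s - t\<bar>) \<longlongrightarrow> 0) (at t within {0..})"

definition PIE_solution :: "real \<Rightarrow> real \<Rightarrow> (real \<Rightarrow> real ^ ('n + 'n + 'n) ^ 'n)
    \<Rightarrow> real ^ ('n + 'n + 'n + 'n) ^ ('n + 'n) \<Rightarrow> (real \<Rightarrow> real \<Rightarrow> real ^ 'n)
    \<Rightarrow> (real \<Rightarrow> real ^ 'n) \<Rightarrow> (real \<Rightarrow> real \<Rightarrow> real ^ 'n::finite) \<Rightarrow> bool" where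
  "PIE_solution a b A B p v0 v \<longleftrightarrow> ae_eq a b (v 0) v0 \<and>
     (\<exists>v_t. \<forall>t\<ge>0. v t \<in> L2 a b \<and>
        has_frechet_deriv (L2 a b) (L2_norm a b) v (v_t t) t \<and>
        ae_eq a b (T1_op a b B (v_t t)) (\<lambda>x. A11_op a b A B (v t) x + p t x))"

text \<open>The state space \<open>X_B\<close> carries the norm of \<open>H\<^sub>2\<close>.\<close>

definition PDE_solution :: "real \<Rightarrow> real \<Rightarrow> (real \<Rightarrow> real ^ ('n + 'n + 'n) ^ 'n)
    \<Rightarrow> real ^ ('n + 'n + 'n + 'n) ^ ('n + 'n) \<Rightarrow> (real \<Rightarrow> real \<Rightarrow> real ^ 'n)
    \<Rightarrow> (real \<Rightarrow> real ^ 'n) \<Rightarrow> (real \<Rightarrow> real \<Rightarrow> real ^ 'n::finite) \<Rightarrow> bool" where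
  "PDE_solution a b A B p u0 u \<longleftrightarrow> ae_eq a b (u 0) u0 \<and>
     (\<exists>u_t. \<forall>t\<ge>0. u t \<in> X_B a b B \<and>
        has_frechet_deriv (H2 a b) (H2_norm a b) u (u_t t) t \<and>
        ae_eq a b (u_t t)
          (\<lambda>x. A x *v (u t x \<triangleright> dx a b (u t) x \<triangleright> dx a b (dx a b (u t)) x) + p t x))"

end

theory Submission
  imports Defs
begin

text \<open>The theorem rests on one fact: \<open>T1_op a b B\<close> is an isomorphism from \<open>L2\<close> onto \<open>X_B\<close> with inverse
\<open>\<partial>\<^sub>x\<^sup>2\<close>, bounded for the norms of \<open>L2\<close> and \<open>H\<^sub>2\<close>, and it turns the right-hand side of the PDE into the
operator \<open>A11_op\<close> of the PIE.

A function \<open>u\<close> in \<open>H\<^sub>2\<close> is, almost everywhere, \<open>c + (x - a) d + \<integral>\<^sub>a\<^sup>x (x - \<theta>) h(\<theta>) d\<theta>\<close> with \<open>h = u\<^sub>x\<^sub>x\<close>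
(\<open>has_weak_deriv_iff\<close>, which is the lemma of du Bois-Reymond, applied twice). The boundary values of
\<open>u\<close> and \<open>u\<^sub>x\<close> are then \<open>H (c, d) + \<integral>\<^sub>a\<^sup>b Q(\<theta>) h(\<theta>) d\<theta>\<close> (\<open>boundary_values\<close>), so the boundary condition
is the linear system \<open>B H (c, d) = - B \<integral>\<^sub>a\<^sup>b Q h\<close>. As \<open>B H\<close> is invertible, \<open>h\<close> determines \<open>(c, d)\<close>
(\<open>boundary_coeffs_unique\<close>), and inserting the solution into the formula for \<open>u\<close> gives exactly
\<open>T1_op a b B h\<close>. Hence \<open>T1_op_in_X_B\<close>, \<open>dx_dx_T1_op\<close> and \<open>T1_op_dx_dx\<close>; differentiating the
formula once gives \<open>A11_op_ae_eq\<close>.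

If \<open>v\<close> solves the PIE, then \<open>T1_op a b B \<circ> v\<close> is differentiable in \<open>H\<^sub>2\<close> with derivative
\<open>T1_op a b B v\<^sub>t\<close> because \<open>T1_op\<close> is linear and bounded (\<open>T1_op_bounded\<close>), and the two equations are the
same. For the converse, \<open>\<partial>\<^sub>x\<^sup>2\<close> is bounded from \<open>H\<^sub>2\<close> to \<open>L2\<close>, so \<open>v = \<partial>\<^sub>x\<^sup>2 u\<close> is differentiable with
derivative \<open>\<partial>\<^sub>x\<^sup>2 u\<^sub>t\<close>. The one delicate point is that the PIE needs \<open>T1_op a b B (\<partial>\<^sub>x\<^sup>2 u\<^sub>t) = u\<^sub>t\<close>, whereas
\<open>u\<^sub>t\<close> is only known to lie in \<open>H\<^sub>2\<close>. The bounded operator \<open>T1_op a b B \<circ> \<partial>\<^sub>x\<^sup>2 - id\<close> vanishes on \<open>X_B\<close>,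
and so it vanishes on limits of difference quotients of curves in \<open>X_B\<close>
(\<open>frechet_deriv_in_range_T1_op\<close>). The second half of the theorem is the first one for
\<open>v = \<partial>\<^sub>x\<^sup>2 u\<close>, as the notion of solution respects equality almost everywhere.\<close>

section \<open>Square integrable functions on an interval\<close>

lemma finite_measure_ivl: "finite_measure (lebesgue_on {a..b::real})"
  by (metis cbox_interval finite_measure_lebesgue_on lmeasurable_cbox)

lemma measure_ivl [simp]: "a \<le> b \<Longrightarrow> measure (lebesgue_on {a..b::real}) {a..b} = b - a"
  by (simp add: measure_restrict_space)

lemma L2_measurable: "f \<in> L2 a b \<Longrightarrow> f \<in> borel_measurable (lebesgue_on {a..b})"
  by (simp add: L2_def)

lemma L2_square_integrable: "f \<in> L2 a b \<Longrightarrow> integrable (lebesgue_on {a..b}) (\<lambda>x. (norm (f x))\<^sup>2)"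
  by (simp add: L2_def)

lemma L2_integrable:
  assumes "f \<in> L2 a b"
  shows "integrable (lebesgue_on {a..b}) f"
proof -
  have [measurable]: "f \<in> borel_measurable (lebesgue_on {a..b})"
    using assms by (rule L2_measurable)
  have "integrable (lebesgue_on {a..b}) (\<lambda>x. norm (f x))"
  proof (rule finite_measure.square_integrable_imp_integrable[OF finite_measure_ivl])
    show "integrable (lebesgue_on {a..b}) (\<lambda>x. (norm (f x))\<^sup>2)"
      using assms by (rule L2_square_integrable)
  qed measurable
  then show ?thesis
    by (subst integrable_norm_iff[symmetric]) simp_all
qed

lemma L2_dominated:
  assumes "f \<in> borel_measurable (lebesgue_on {a..b})"
    and "integrable (lebesgue_on {a..b}) h"
    and "AE x in lebesgue_on {a..b}. (norm (f x))\<^sup>2 \<le> h x"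
  shows "f \<in> L2 a b"
proof -
  have [measurable]: "f \<in> borel_measurable (lebesgue_on {a..b})" by fact
  have "integrable (lebesgue_on {a..b}) (\<lambda>x. (norm (f x))\<^sup>2)"
    by (rule Bochner_Integration.integrable_bound[OF assms(2)]) (use assms(3) in \<open>auto elim!: eventually_mono\<close>)
  then show ?thesis
    using assms(1) by (simp add: L2_def)
qed

text \<open>The arguments below compare squared norms, for which this replaces the triangle inequality in \<open>L2\<close>
  at the price of a factor \<open>2\<close>.\<close>

lemma norm_add_square_le:
  fixes u v :: "'c::real_normed_vector"
  shows "(norm (u + v))\<^sup>2 \<le> 2 * (norm u)\<^sup>2 + 2 * (norm v)\<^sup>2"
proof -
  have "(norm (u + v))\<^sup>2 \<le> (norm u + norm v)\<^sup>2"
    by (simp add: norm_triangle_ineq power_mono)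
  moreover have "0 \<le> (norm u - norm v)\<^sup>2" by simp
  ultimately show ?thesis
    by (simp add: power2_eq_square algebra_simps)
qed

lemma L2_add:
  assumes "f \<in> L2 a b" "g \<in> L2 a b"
  shows "(\<lambda>x. f x + g x) \<in> L2 a b"
proof (rule L2_dominated)
  show "integrable (lebesgue_on {a..b}) (\<lambda>x. 2 * (norm (f x))\<^sup>2 + 2 * (norm (g x))\<^sup>2)"
    using assms by (simp add: L2_square_integrable)
  show "(\<lambda>x. f x + g x) \<in> borel_measurable (lebesgue_on {a..b})"
    using assms by (intro borel_measurable_add L2_measurable)
qed (simp add: norm_add_square_le)

lemma L2_linear:
  assumes "linear T" "f \<in> L2 a b"
  shows "(\<lambda>x. T (f x)) \<in> L2 a b"
proof -
  from linear_bounded[OF assms(1)] obtain K where K: "\<And>x. norm (T x) \<le> K * norm x" by blast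
  have "T \<in> borel_measurable borel"
    using assms(1) by (intro borel_measurable_continuous_onI linear_continuous_on linear_conv_bounded_linear[THEN iffD1])
  then have m: "(\<lambda>x. T (f x)) \<in> borel_measurable (lebesgue_on {a..b})"
    using L2_measurable[OF assms(2)] by measurable
  show ?thesis
  proof (rule L2_dominated[OF m])
    show "integrable (lebesgue_on {a..b}) (\<lambda>x. K\<^sup>2 * (norm (f x))\<^sup>2)"
      using assms by (simp add: L2_square_integrable)
    show "AE x in lebesgue_on {a..b}. (norm (T (f x)))\<^sup>2 \<le> K\<^sup>2 * (norm (f x))\<^sup>2"
      using power_mono[OF K, of _ 2] by (simp add: power_mult_distrib)
  qed
qed

lemma L2_scaleR: "f \<in> L2 a b \<Longrightarrow> (\<lambda>x. c *\<^sub>R f x) \<in> L2 a b"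
  by (rule L2_linear) (auto intro!: linearI simp: algebra_simps)

lemma L2_diff:
  assumes "f \<in> L2 a b" "g \<in> L2 a b"
  shows "(\<lambda>x. f x - g x) \<in> L2 a b"
  using L2_add[OF assms(1) L2_scaleR[OF assms(2), of "-1"]] by simp

lemma continuous_L2:
  fixes f :: "real \<Rightarrow> 'c::euclidean_space"
  assumes "continuous_on {a..b} f"
  shows "f \<in> L2 a b"
proof -
  have "f \<in> borel_measurable (lebesgue_on {a..b})"
    using assms by (simp add: continuous_imp_measurable_on_sets_lebesgue)
  moreover have "integrable (lebesgue_on {a..b}) (\<lambda>x. (norm (f x))\<^sup>2)"
    using assms by (intro continuous_imp_integrable_real continuous_intros)
  ultimately show ?thesis
    by (simp add: L2_def)
qed

lemma ae_eq_refl: "ae_eq a b f f"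
  by (simp add: ae_eq_def)

lemma ae_eq_sym: "ae_eq a b f g \<Longrightarrow> ae_eq a b g f"
  unfolding ae_eq_def by (auto elim: eventually_mono)

lemma ae_eq_trans: "ae_eq a b f g \<Longrightarrow> ae_eq a b g h \<Longrightarrow> ae_eq a b f h"
  unfolding ae_eq_def by (auto elim: eventually_elim2)

lemma ae_eqI: "(\<And>x. a \<le> x \<Longrightarrow> x \<le> b \<Longrightarrow> f x = g x) \<Longrightarrow> ae_eq a b f g"
  unfolding ae_eq_def by (rule AE_I2) simp

text \<open>The measurability of \<open>g\<close> comes from the completeness of Lebesgue measure.\<close>

lemma L2_ae_cong:
  fixes f g :: "real \<Rightarrow> 'c::euclidean_space"
  assumes "ae_eq a b f g" "f \<in> L2 a b"
  shows "g \<in> L2 a b"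
proof (rule L2_dominated)
  show "integrable (lebesgue_on {a..b}) (\<lambda>x. (norm (f x))\<^sup>2)"
    using assms by (simp add: L2_square_integrable)
  show "AE x in lebesgue_on {a..b}. (norm (g x))\<^sup>2 \<le> (norm (f x))\<^sup>2"
    using assms(1) unfolding ae_eq_def by eventually_elim simp
  show "g \<in> borel_measurable (lebesgue_on {a..b})"
  proof -
    let ?f = "\<lambda>x. if x \<in> {a..b} then f x else 0" and ?g = "\<lambda>x. if x \<in> {a..b} then g x else 0"
    have "?f \<in> borel_measurable lebesgue"
      by (rule borel_measurable_if_I[OF L2_measurable[OF assms(2)]]) simp
    moreover have "AE x in lebesgue. ?f x = ?g x"
      using assms(1) unfolding ae_eq_def by (subst (asm) AE_restrict_space_iff) (auto elim!: eventually_mono)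
    ultimately have "?g \<in> borel_measurable lebesgue"
      by (rule borel_measurable_AE)
    then show ?thesis by (rule borel_measurable_if_D)
  qed
qed

lemma L2_norm_square: "(L2_norm a b f)\<^sup>2 = (\<integral>x. (norm (f x))\<^sup>2 \<partial>lebesgue_on {a..b})"
  by (simp add: L2_norm_def)

lemma L2_norm_nonneg [simp]: "0 \<le> L2_norm a b f"
  by (simp add: L2_norm_def)

lemma L2_norm_cong:
  assumes "ae_eq a b f g" "f \<in> L2 a b"
  shows "L2_norm a b f = L2_norm a b g"
proof -
  have m: "f \<in> borel_measurable (lebesgue_on {a..b})" "g \<in> borel_measurable (lebesgue_on {a..b})"
    using assms L2_ae_cong[OF assms] by (auto intro: L2_measurable)
  have "(\<integral>x. (norm (f x))\<^sup>2 \<partial>lebesgue_on {a..b}) = (\<integral>x. (norm (g x))\<^sup>2 \<partial>lebesgue_on {a..b})"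
  proof (rule integral_cong_AE)
    show "AE x in lebesgue_on {a..b}. (norm (f x))\<^sup>2 = (norm (g x))\<^sup>2"
      using assms(1) unfolding ae_eq_def by eventually_elim simp
  qed (use m in measurable)
  then show ?thesis by (simp add: L2_norm_def)
qed

lemma L2_norm_add_square_le:
  assumes "f \<in> L2 a b" "g \<in> L2 a b"
  shows "(L2_norm a b (\<lambda>x. f x + g x))\<^sup>2 \<le> 2 * (L2_norm a b f)\<^sup>2 + 2 * (L2_norm a b g)\<^sup>2"
proof -
  have "(L2_norm a b (\<lambda>x. f x + g x))\<^sup>2 \<le> (\<integral>x. 2 * (norm (f x))\<^sup>2 + 2 * (norm (g x))\<^sup>2 \<partial>lebesgue_on {a..b})"
    unfolding L2_norm_square
    by (rule integral_mono) (use assms L2_add[OF assms] in \<open>auto simp: L2_square_integrable norm_add_square_le\<close>)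
  also have "\<dots> = 2 * (L2_norm a b f)\<^sup>2 + 2 * (L2_norm a b g)\<^sup>2"
    using assms by (simp add: L2_norm_square L2_square_integrable)
  finally show ?thesis .
qed

lemma L2_norm_scaleR: "L2_norm a b (\<lambda>x. c *\<^sub>R f x) = \<bar>c\<bar> * L2_norm a b f"
proof -
  have "(\<integral>x. (norm (c *\<^sub>R f x))\<^sup>2 \<partial>lebesgue_on {a..b}) = c\<^sup>2 * (\<integral>x. (norm (f x))\<^sup>2 \<partial>lebesgue_on {a..b})"
    by (simp add: power_mult_distrib)
  then show ?thesis
    by (simp add: L2_norm_def real_sqrt_mult)
qed

lemma L2_norm_diff_square_le:
  assumes "f \<in> L2 a b" "g \<in> L2 a b"
  shows "(L2_norm a b (\<lambda>x. f x - g x))\<^sup>2 \<le> 2 * (L2_norm a b f)\<^sup>2 + 2 * (L2_norm a b g)\<^sup>2"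
  using L2_norm_add_square_le[OF assms(1) L2_scaleR[OF assms(2), of "-1"]]
    L2_norm_scaleR[of a b "-1" g] by simp

lemma L2_norm_square_le_const:
  assumes "a \<le> b" "f \<in> L2 a b" "\<And>x. a \<le> x \<Longrightarrow> x \<le> b \<Longrightarrow> (norm (f x))\<^sup>2 \<le> C"
  shows "(L2_norm a b f)\<^sup>2 \<le> (b - a) * C"
proof -
  have "(L2_norm a b f)\<^sup>2 \<le> (\<integral>x. C \<partial>lebesgue_on {a..b})"
    unfolding L2_norm_square using assms by (intro integral_mono) (auto simp: L2_square_integrable)
  then show ?thesis
    using assms(1) by simp
qed

lemma L2_norm_zero_imp_ae_eq:
  assumes "f \<in> L2 a b" "L2_norm a b f = 0"
  shows "ae_eq a b f (\<lambda>x. 0)"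
proof -
  have "(\<integral>x. (norm (f x))\<^sup>2 \<partial>lebesgue_on {a..b}) = 0"
    using assms(2) L2_norm_square[of a b f] by simp
  then have "AE x in lebesgue_on {a..b}. (norm (f x))\<^sup>2 = 0"
    using integral_nonneg_eq_0_iff_AE[OF L2_square_integrable[OF assms(1)]] by simp
  then show ?thesis by (simp add: ae_eq_def)
qed

text \<open>The Cauchy-Schwarz inequality against the constant function \<open>1\<close>. It follows from the nonnegativity
  of the variance of \<open>norm \<circ> g\<close>.\<close>

lemma norm_integral_square_le:
  assumes "a \<le> x" "x \<le> b" "g \<in> L2 a b"
  shows "(norm (\<integral>\<theta>. g \<theta> \<partial>lebesgue_on {a..x}))\<^sup>2 \<le> (b - a) * (L2_norm a b g)\<^sup>2"
proof (cases "a = b")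
  case True
  then have "(\<integral>\<theta>. g \<theta> \<partial>lebesgue_on {a..x}) = 0"
    using assms by (intro integral_eq_zero_null_sets) auto
  then show ?thesis using True by simp
next
  case False
  with assms have ab: "0 < b - a" by simp
  let ?M = "lebesgue_on {a..b}"
  have int: "integrable ?M (\<lambda>x. norm (g x))"
    using assms by (intro integrable_norm L2_integrable)
  have 1: "norm (\<integral>\<theta>. g \<theta> \<partial>lebesgue_on {a..x}) \<le> (\<integral>\<theta>. norm (g \<theta>) \<partial>?M)" (is "_ \<le> ?I")
  proof -
    have "norm (\<integral>\<theta>. g \<theta> \<partial>lebesgue_on {a..x}) \<le> (\<integral>\<theta>. norm (g \<theta>) \<partial>lebesgue_on {a..x})"
      by (rule integral_norm_bound)
    also have "\<dots> \<le> ?I"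
      using int assms integral_combine[OF int, of x] by simp
    finally show ?thesis .
  qed
  \<comment> \<open>The mean of \<open>norm \<circ> g\<close>, the choice that makes the following inequality sharp.\<close>
  define m where "m = ?I / (b - a)"
  have "0 \<le> (\<integral>\<theta>. (norm (g \<theta>) - m)\<^sup>2 \<partial>?M)"
    by (rule integral_nonneg_AE) simp
  also have "(\<lambda>\<theta>. (norm (g \<theta>) - m)\<^sup>2) = (\<lambda>\<theta>. (norm (g \<theta>))\<^sup>2 - 2 * m * norm (g \<theta>) + m\<^sup>2)"
    by (simp add: power2_diff algebra_simps)
  also have "(\<integral>\<theta>. (norm (g \<theta>))\<^sup>2 - 2 * m * norm (g \<theta>) + m\<^sup>2 \<partial>?M)
      = (L2_norm a b g)\<^sup>2 - 2 * m * ?I + (b - a) * m\<^sup>2"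
    using int assms by (simp add: L2_norm_square L2_square_integrable)
  also have "\<dots> = (L2_norm a b g)\<^sup>2 - ?I\<^sup>2 / (b - a)"
    using ab unfolding m_def by (simp add: divide_simps power2_eq_square)
  finally have "?I\<^sup>2 \<le> (b - a) * (L2_norm a b g)\<^sup>2"
    using ab by (simp add: pos_divide_le_eq mult.commute)
  moreover have "(norm (\<integral>\<theta>. g \<theta> \<partial>lebesgue_on {a..x}))\<^sup>2 \<le> ?I\<^sup>2"
    using power_mono[OF 1 norm_ge_zero] .
  ultimately show ?thesis by linarith
qed

section \<open>Indefinite integrals of integrable functions\<close>

text \<open>The sets with vanishing integral form a Dynkin system, and the rays are an intersection-stable
  generator of the Borel sets.\<close>

lemma integral_borel_eq_zero:
  fixes w :: "real \<Rightarrow> real"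
  assumes w: "integrable lebesgue w"
    and rays: "\<And>x. (LINT y:{..x}|lebesgue. w y) = 0" and total: "(LINT y|lebesgue. w y) = 0"
    and A: "A \<in> sets borel"
  shows "(LINT y:A|lebesgue. w y) = 0"
proof -
  let ?G = "range (\<lambda>x::real. {..x})"
  have G: "sets borel = sigma_sets UNIV ?G"
    by (subst borel_eq_atMost) simp
  have sub: "sigma_sets UNIV ?G \<subseteq> sets lebesgue"
    using G by auto
  have set_int: "set_integrable lebesgue S w" if "S \<in> sigma_sets UNIV ?G" for S
    unfolding set_integrable_def using that sub w by (intro integrable_mult_indicator) auto
  have "Int_stable ?G"
    by (auto simp: Int_stable_def)
  moreover have "?G \<subseteq> Pow UNIV" by simp
  moreover have "A \<in> sigma_sets UNIV ?G"
    using A G by simp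
  ultimately show ?thesis
  proof (induction rule: sigma_sets_induct_disjoint)
    case (basic A)
    then show ?case using rays by auto
  next
    case empty
    show ?case by (simp add: set_lebesgue_integral_def)
  next
    case (compl A)
    have "(LINT y:UNIV - A|lebesgue. w y) = (LINT y|lebesgue. w y - indicator A y *\<^sub>R w y)"
      unfolding set_lebesgue_integral_def
      by (rule Bochner_Integration.integral_cong) (auto simp: indicator_def)
    also have "\<dots> = 0"
      using w set_int[OF compl(1)] compl(2) total by (simp add: set_integrable_def set_lebesgue_integral_def)
    finally show ?case .
  next
    case (union A)
    have "(LINT y:(\<Union>i. A i)|lebesgue. w y) = (\<Sum>i. (LINT y:A i|lebesgue. w y))"
    proof (rule lebesgue_integral_countable_add)
      show "set_integrable lebesgue (\<Union>i. A i) w"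
        using union by (intro set_int sigma_sets.Union) auto
      show "A i \<in> sets lebesgue" for i
        using union(2) sub by blast
    qed (use union(1) in \<open>auto simp: disjoint_family_on_def\<close>)
    then show ?case using union by simp
  qed
qed

text \<open>With the integrals over the intervals \<open>{a..x}\<close>, those over all measurable sets vanish, and this forces
  \<open>g\<close> to vanish almost everywhere; the differentiation theorem for integrals can be avoided.\<close>

lemma integral_ivl_zero_imp_ae_zero_real:
  fixes g :: "real \<Rightarrow> real"
  assumes g: "integrable (lebesgue_on {a..b}) g"
    and zero: "\<And>x. a \<le> x \<Longrightarrow> x \<le> b \<Longrightarrow> (\<integral>\<theta>. g \<theta> \<partial>lebesgue_on {a..x}) = 0"
  shows "AE x in lebesgue_on {a..b}. g x = 0"
proof -
  define w where "w = (\<lambda>x. if x \<in> {a..b} then g x else 0)"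
  have w: "integrable lebesgue w"
    unfolding w_def using g by (subst Lebesgue_Measure.integrable_restrict_UNIV) simp_all
  have ray: "(LINT y:{..x}|lebesgue. w y) = 0" for x
  proof -
    have "(LINT y:{..x}|lebesgue. w y) = (LINT y|lebesgue. (if y \<in> {a..min x b} then g y else 0))"
      unfolding set_lebesgue_integral_def w_def
      by (rule Bochner_Integration.integral_cong) (auto simp: indicator_def)
    also have "\<dots> = (\<integral>\<theta>. g \<theta> \<partial>lebesgue_on {a..min x b})"
      by (rule Lebesgue_Measure.integral_restrict_UNIV) simp
    also have "\<dots> = 0"
    proof (cases "a \<le> min x b")
      case True
      then show ?thesis by (intro zero) simp_all
    next
      case False
      then have "{a..min x b} = {}" by auto
      then show ?thesis by (simp only: integral_lebesgue_on_empty)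
    qed
    finally show ?thesis .
  qed
  have total: "(LINT y|lebesgue. w y) = 0"
  proof -
    have "(LINT y|lebesgue. w y) = (LINT y:{..b}|lebesgue. w y)"
      unfolding set_lebesgue_integral_def w_def
      by (rule Bochner_Integration.integral_cong) (auto simp: indicator_def)
    then show ?thesis using ray by simp
  qed
  have "AE x in lebesgue. w x = 0"
  proof (rule density_unique_real)
    \<comment> \<open>A Lebesgue measurable set differs from a Borel set by a null set.\<close>
    fix A :: "real set" assume "A \<in> sets lebesgue"
    then obtain S N N' where S: "A = S \<union> N" "N \<subseteq> N'" "N' \<in> null_sets lborel" "S \<in> sets lborel"
      by (rule sets_completionE)
    have "N' \<in> null_sets lebesgue"
      using S(3) by (rule null_sets_completionI)
    then have "AE x in lebesgue. x \<notin> N'"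
      by (rule AE_not_in)
    then have "AE x in lebesgue. indicator A x *\<^sub>R w x = indicator S x *\<^sub>R w x"
      by eventually_elim (use S in \<open>auto simp: indicator_def\<close>)
    then have "(LINT y:A|lebesgue. w y) = (LINT y:S|lebesgue. w y)"
      unfolding set_lebesgue_integral_def using w \<open>A \<in> sets lebesgue\<close> S(4)
      by (intro integral_cong_AE borel_measurable_scaleR borel_measurable_indicator) auto
    also have "\<dots> = 0"
      using S(4) by (intro integral_borel_eq_zero[OF w ray total]) simp
    finally show "(LINT y:A|lebesgue. w y) = (LINT y:A|lebesgue. 0)"
      by (simp add: set_lebesgue_integral_def)
  qed (use w in simp_all)
  then show ?thesis
    unfolding w_def by (subst AE_restrict_space_iff) (auto elim!: eventually_mono)
qed

lemma integral_ivl_zero_imp_ae_zero: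
  fixes g :: "real \<Rightarrow> 'c::euclidean_space"
  assumes g: "integrable (lebesgue_on {a..b}) g"
    and zero: "\<And>x. a \<le> x \<Longrightarrow> x \<le> b \<Longrightarrow> (\<integral>\<theta>. g \<theta> \<partial>lebesgue_on {a..x}) = 0"
  shows "AE x in lebesgue_on {a..b}. g x = 0"
proof -
  have "AE x in lebesgue_on {a..b}. \<forall>i\<in>Basis. g x \<bullet> i = 0"
  proof (rule AE_finite_allI)
    fix i :: 'c assume "i \<in> Basis"
    show "AE x in lebesgue_on {a..b}. g x \<bullet> i = 0"
    proof (rule integral_ivl_zero_imp_ae_zero_real)
      fix x assume x: "a \<le> x" "x \<le> b"
      then have "integrable (lebesgue_on {a..x}) g"
        using integrable_subinterval[OF g] by simp
      then show "(\<integral>\<theta>. g \<theta> \<bullet> i \<partial>lebesgue_on {a..x}) = 0"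
        using zero[OF x] by simp
    qed (use g in simp)
  qed simp
  then show ?thesis
    by eventually_elim (auto intro: euclidean_eqI)
qed

text \<open>Integration by parts with one factor that is only absolutely continuous: both sides are the integral
  of \<open>\<phi>'(x) g(\<theta>)\<close> over the triangle \<open>a \<le> \<theta> \<le> x \<le> b\<close>.\<close>

lemma integral_prim_by_parts:
  fixes g :: "real \<Rightarrow> 'c::euclidean_space"
  assumes "a \<le> b" and g: "integrable (lebesgue_on {a..b}) g"
    and deriv: "\<And>x. a \<le> x \<Longrightarrow> x \<le> b \<Longrightarrow> (\<phi> has_vector_derivative \<phi>' x) (at x within {a..b})"
    and cont: "continuous_on {a..b} \<phi>'"
  shows "(\<integral>x. \<phi>' x *\<^sub>R (\<integral>\<theta>. g \<theta> \<partial>lebesgue_on {a..x}) \<partial>lebesgue_on {a..b})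
       = \<phi> b *\<^sub>R (\<integral>\<theta>. g \<theta> \<partial>lebesgue_on {a..b}) - (\<integral>\<theta>. \<phi> \<theta> *\<^sub>R g \<theta> \<partial>lebesgue_on {a..b})"
proof -
  let ?M = "lebesgue_on {a..b}"
  interpret finite_measure ?M by (rule finite_measure_ivl)
  interpret pair_sigma_finite ?M ?M ..
  \<comment> \<open>The integrand on the triangle, extended by zero to the square.\<close>
  define F where "F x \<theta> = (if \<theta> \<le> x then \<phi>' x *\<^sub>R g \<theta> else 0)" for x \<theta>
  have [measurable]: "g \<in> borel_measurable ?M" "\<phi>' \<in> borel_measurable ?M" "(\<lambda>x. x) \<in> borel_measurable ?M"
    using g cont continuous_on_id[of "{a..b}"] by (auto intro: continuous_imp_measurable_on_sets_lebesgue)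
  have sub: "integrable (lebesgue_on {a..x}) g" if "x \<in> {a..b}" for x
    using integrable_subinterval[OF g, of a x] that by simp
  have restrict: "(\<integral>\<theta>. (if \<theta> \<le> x then h \<theta> else 0) \<partial>?M) = (\<integral>\<theta>. h \<theta> \<partial>lebesgue_on {a..x})"
    if "x \<in> {a..b}" for x and h :: "real \<Rightarrow> 'e::euclidean_space"
  proof -
    have "(\<integral>\<theta>. (if \<theta> \<le> x then h \<theta> else 0) \<partial>?M) = (\<integral>\<theta>. (if \<theta> \<in> {a..x} then h \<theta> else 0) \<partial>?M)"
      by (rule Bochner_Integration.integral_cong) auto
    also have "\<dots> = (\<integral>\<theta>. h \<theta> \<partial>lebesgue_on {a..x})"
      using that by (intro integral_restrict) auto
    finally show ?thesis .
  qed
  have inner1: "(\<integral>\<theta>. F x \<theta> \<partial>?M) = \<phi>' x *\<^sub>R (\<integral>\<theta>. g \<theta> \<partial>lebesgue_on {a..x})" if "x \<in> {a..b}" for x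
    unfolding F_def restrict[OF that, of "\<lambda>\<theta>. \<phi>' x *\<^sub>R g \<theta>"] by simp
  have inner2: "(\<integral>x. F x \<theta> \<partial>?M) = (\<phi> b - \<phi> \<theta>) *\<^sub>R g \<theta>" if \<theta>: "\<theta> \<in> {a..b}" for \<theta>
  proof -
    have "(\<integral>x. F x \<theta> \<partial>?M) = (\<integral>x. (if x \<in> {\<theta>..b} then \<phi>' x else 0) *\<^sub>R g \<theta> \<partial>?M)"
      unfolding F_def by (rule Bochner_Integration.integral_cong) auto
    also have "\<dots> = (\<integral>x. (if x \<in> {\<theta>..b} then \<phi>' x else 0) \<partial>?M) *\<^sub>R g \<theta>"
    proof (rule integral_scaleR_left)
      have "integrable ?M \<phi>'"
        using cont by (rule continuous_imp_integrable_real)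
      then show "integrable ?M (\<lambda>x. if x \<in> {\<theta>..b} then \<phi>' x else 0)"
        by (rule Bochner_Integration.integrable_bound) auto
    qed
    also have "(\<integral>x. (if x \<in> {\<theta>..b} then \<phi>' x else 0) \<partial>?M) = (\<integral>x. \<phi>' x \<partial>lebesgue_on {\<theta>..b})"
      using \<theta> by (intro integral_restrict) auto
    also have "\<dots> = \<phi> b - \<phi> \<theta>"
    proof -
      have c: "continuous_on {\<theta>..b} \<phi>'"
        using cont by (rule continuous_on_subset) (use \<theta> in auto)
      have "(\<phi>' has_integral (\<phi> b - \<phi> \<theta>)) {\<theta>..b}"
        using \<theta> by (intro fundamental_theorem_of_calculus) (auto intro: has_vector_derivative_within_subset[OF deriv])
      then show ?thesis
        using c by (simp add: lebesgue_integral_eq_integral continuous_imp_integrable_real integral_unique)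
    qed
    finally show ?thesis .
  qed
  have "integrable (?M \<Otimes>\<^sub>M ?M) (case_prod F)"
  proof (rule Fubini_integrable)
    show "case_prod F \<in> borel_measurable (?M \<Otimes>\<^sub>M ?M)"
      unfolding F_def by measurable
    have "continuous_on {a..b} (\<lambda>x. \<bar>\<phi>' x\<bar> * (\<integral>\<theta>. norm (g \<theta>) \<partial>lebesgue_on {a..x}))"
      using cont g by (intro continuous_intros indefinite_integral_continuous_real integrable_norm)
    then have "integrable ?M (\<lambda>x. \<bar>\<phi>' x\<bar> * (\<integral>\<theta>. norm (g \<theta>) \<partial>lebesgue_on {a..x}))"
      by (rule continuous_imp_integrable_real)
    also have "?this \<longleftrightarrow> integrable ?M (\<lambda>x. \<integral>y. norm (case_prod F (x, y)) \<partial>?M)"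
    proof (rule Bochner_Integration.integrable_cong)
      fix x assume "x \<in> space ?M"
      then have x: "x \<in> {a..b}" by simp
      have "(\<integral>y. norm (case_prod F (x, y)) \<partial>?M) = (\<integral>y. (if y \<le> x then \<bar>\<phi>' x\<bar> * norm (g y) else 0) \<partial>?M)"
        unfolding F_def by (rule Bochner_Integration.integral_cong) auto
      then show "\<bar>\<phi>' x\<bar> * (\<integral>\<theta>. norm (g \<theta>) \<partial>lebesgue_on {a..x}) = (\<integral>y. norm (case_prod F (x, y)) \<partial>?M)"
        using restrict[OF x, of "\<lambda>y. \<bar>\<phi>' x\<bar> * norm (g y)"] by simp
    qed simp
    finally show "integrable ?M (\<lambda>x. \<integral>y. norm (case_prod F (x, y)) \<partial>?M)" .
    show "AE x in ?M. integrable ?M (\<lambda>y. case_prod F (x, y))"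
    proof (rule AE_I2)
      fix x
      show "integrable ?M (\<lambda>y. case_prod F (x, y))"
      proof (rule Bochner_Integration.integrable_bound)
        show "integrable ?M (\<lambda>y. \<phi>' x *\<^sub>R g y)" using g by simp
      qed (auto simp: F_def)
    qed
  qed
  from Fubini_integral[OF this]
  have "(\<integral>x. (\<integral>\<theta>. F x \<theta> \<partial>?M) \<partial>?M) = (\<integral>\<theta>. (\<integral>x. F x \<theta> \<partial>?M) \<partial>?M)" ..
  moreover have "(\<integral>x. (\<integral>\<theta>. F x \<theta> \<partial>?M) \<partial>?M) = (\<integral>x. \<phi>' x *\<^sub>R (\<integral>\<theta>. g \<theta> \<partial>lebesgue_on {a..x}) \<partial>?M)"
    by (rule Bochner_Integration.integral_cong) (simp_all add: inner1)
  moreover have "(\<integral>\<theta>. (\<integral>x. F x \<theta> \<partial>?M) \<partial>?M) = (\<integral>\<theta>. \<phi> b *\<^sub>R g \<theta> - \<phi> \<theta> *\<^sub>R g \<theta> \<partial>?M)"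
    by (rule Bochner_Integration.integral_cong) (simp_all add: inner2 algebra_simps)
  moreover have "integrable ?M (\<lambda>\<theta>. \<phi> \<theta> *\<^sub>R g \<theta>)"
  proof -
    have "continuous_on {a..b} \<phi>"
      using deriv by (intro continuous_on_vector_derivative) auto
    then have "bounded (\<phi> ` {a..b})"
      by (intro compact_imp_bounded compact_continuous_image) simp_all
    then obtain C where C: "\<And>x. x \<in> {a..b} \<Longrightarrow> norm (\<phi> x) \<le> C"
      unfolding bounded_iff by blast
    have [measurable]: "\<phi> \<in> borel_measurable ?M"
      using \<open>continuous_on {a..b} \<phi>\<close> by (auto intro: continuous_imp_measurable_on_sets_lebesgue)
    show ?thesis
    proof (rule Bochner_Integration.integrable_bound)
      show "integrable ?M (\<lambda>y. C *\<^sub>R g y)" using g by simp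
      show "AE x in ?M. norm (\<phi> x *\<^sub>R g x) \<le> norm (C *\<^sub>R g x)"
        using C by (intro AE_I2) (force intro!: mult_right_mono)
    qed measurable
  qed
  ultimately show ?thesis
    using g by simp
qed

text \<open>Cauchy's formula for repeated integration, by parts with \<open>\<phi> y = y - x\<close>. It connects the kernel
  \<open>x - \<theta>\<close> of \<open>T1\<close> with two successive integrations.\<close>

lemma integral_integral_eq:
  fixes h :: "real \<Rightarrow> 'c::euclidean_space"
  assumes h: "integrable (lebesgue_on {a..b}) h" and x: "a \<le> x" "x \<le> b"
  shows "(\<integral>y. (\<integral>\<theta>. h \<theta> \<partial>lebesgue_on {a..y}) \<partial>lebesgue_on {a..x}) = (\<integral>\<theta>. (x - \<theta>) *\<^sub>R h \<theta> \<partial>lebesgue_on {a..x})"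
proof -
  have "integrable (lebesgue_on {a..x}) h"
    using integrable_subinterval[OF h] x by simp
  moreover have "((\<lambda>y. y - x) has_vector_derivative 1) (at y within {a..x})" for y
    by (auto intro!: derivative_eq_intros)
  ultimately have "(\<integral>y. 1 *\<^sub>R (\<integral>\<theta>. h \<theta> \<partial>lebesgue_on {a..y}) \<partial>lebesgue_on {a..x})
      = (x - x) *\<^sub>R (\<integral>\<theta>. h \<theta> \<partial>lebesgue_on {a..x}) - (\<integral>\<theta>. (\<theta> - x) *\<^sub>R h \<theta> \<partial>lebesgue_on {a..x})"
    using x by (intro integral_prim_by_parts) auto
  also have "\<dots> = (\<integral>\<theta>. - ((\<theta> - x) *\<^sub>R h \<theta>) \<partial>lebesgue_on {a..x})"
    by simp
  also have "(\<lambda>\<theta>. - ((\<theta> - x) *\<^sub>R h \<theta>)) = (\<lambda>\<theta>. (x - \<theta>) *\<^sub>R h \<theta>)"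
    by (simp add: algebra_simps)
  finally show ?thesis by simp
qed

section \<open>Weakly differentiable functions as indefinite integrals\<close>

lemma test_functionE:
  assumes "test_function a b \<phi>"
  obtains D where "\<And>x. (\<phi> has_vector_derivative D x) (at x)" "continuous_on UNIV D" "deriv \<phi> = D"
    "continuous_on UNIV \<phi>" "\<phi> a = 0" "\<phi> b = 0"
proof -
  obtain D S where D: "\<And>x. (\<phi> has_vector_derivative D x) (at x)" "continuous_on UNIV D"
    and S: "S \<subseteq> {a<..<b}" "\<And>x. x \<notin> S \<Longrightarrow> \<phi> x = 0"
    using assms unfolding test_function_def C1_differentiable_on_def by blast
  have "deriv \<phi> x = D x" for x
    using D(1)[of x] by (intro DERIV_imp_deriv) (simp add: has_real_derivative_iff_has_vector_derivative)
  moreover have "continuous_on UNIV \<phi>"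
    using D(1) by (intro continuous_on_vector_derivative) auto
  moreover have "a \<notin> S" "b \<notin> S" using S(1) by auto
  ultimately show ?thesis
    using D S(2) by (intro that[of D]) auto
qed

text \<open>Test functions vanish at both end points. Hence integration by parts leaves no boundary term, and the
  constant \<open>c\<close> is orthogonal to their derivatives.\<close>

lemma has_weak_deriv_primitive:
  assumes ab: "a \<le> b" and g: "g \<in> L2 a b"
    and u: "ae_eq a b u (\<lambda>x. c + (\<integral>\<theta>. g \<theta> \<partial>lebesgue_on {a..x}))"
  shows "has_weak_deriv a b u g"
proof -
  let ?P = "\<lambda>x. \<integral>\<theta>. g \<theta> \<partial>lebesgue_on {a..x}"
  let ?M = "lebesgue_on {a..b}"
  have gi: "integrable ?M g" using g by (rule L2_integrable)
  then have contP: "continuous_on {a..b} ?P"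
    by (rule indefinite_integral_continuous_real)
  have uL2: "u \<in> L2 a b"
  proof (rule L2_ae_cong[OF ae_eq_sym[OF u]])
    show "(\<lambda>x. c + ?P x) \<in> L2 a b"
      using contP by (intro continuous_L2 continuous_intros)
  qed
  have "(\<integral>x. deriv \<phi> x *\<^sub>R u x \<partial>?M) = - (\<integral>x. \<phi> x *\<^sub>R g x \<partial>?M)" if "test_function a b \<phi>" for \<phi>
  proof -
    obtain D where D: "\<And>x. (\<phi> has_vector_derivative D x) (at x)" "continuous_on UNIV D" "deriv \<phi> = D"
      and \<phi>: "continuous_on UNIV \<phi>" "\<phi> a = 0" "\<phi> b = 0"
      using test_functionE[OF \<open>test_function a b \<phi>\<close>] by blast
    have contD: "continuous_on {a..b} D"
      using D(2) by (rule continuous_on_subset) simp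
    have [measurable]: "D \<in> borel_measurable ?M" "?P \<in> borel_measurable ?M" "u \<in> borel_measurable ?M"
      using contD contP uL2 by (auto intro: continuous_imp_measurable_on_sets_lebesgue L2_measurable)
    have "(\<integral>x. D x *\<^sub>R u x \<partial>?M) = (\<integral>x. D x *\<^sub>R c + D x *\<^sub>R ?P x \<partial>?M)"
      by (rule integral_cong_AE) (use u in \<open>auto simp: ae_eq_def scaleR_add_right[symmetric] elim!: eventually_mono\<close>)
    also have "\<dots> = (\<integral>x. D x *\<^sub>R c \<partial>?M) + (\<integral>x. D x *\<^sub>R ?P x \<partial>?M)"
      using contD contP
      by (intro Bochner_Integration.integral_add continuous_imp_integrable_real continuous_intros)
    also have "(\<integral>x. D x *\<^sub>R c \<partial>?M) = 0"
    proof -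
      have "integrable ?M D" using contD by (rule continuous_imp_integrable_real)
      moreover have "(D has_integral (\<phi> b - \<phi> a)) {a..b}"
        using ab D(1) by (intro fundamental_theorem_of_calculus) (auto intro: has_vector_derivative_at_within)
      ultimately have "(\<integral>x. D x \<partial>?M) = 0"
        using \<phi> by (simp add: lebesgue_integral_eq_integral integral_unique)
      then show ?thesis
        using \<open>integrable ?M D\<close> by simp
    qed
    also have "(\<integral>x. D x *\<^sub>R ?P x \<partial>?M) = - (\<integral>x. \<phi> x *\<^sub>R g x \<partial>?M)"
      by (subst integral_prim_by_parts[OF ab gi _ contD, of \<phi>])
        (use \<phi> D(1) in \<open>auto intro: has_vector_derivative_at_within\<close>)
    finally show ?thesis using D(3) by simp
  qed
  with uL2 g show ?thesis
    by (simp add: has_weak_deriv_def)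
qed

text \<open>The derivatives of test functions are the continuous functions with compact support in the open
  interval and mean zero; this is the harder inclusion.\<close>

lemma test_function_antiderivative:
  assumes f: "continuous_on UNIV f" and supp: "a < lo" "lo \<le> hi" "hi < b" "\<And>x. x \<notin> {lo..hi} \<Longrightarrow> f x = 0"
    and int: "(\<integral>x. f x \<partial>lebesgue_on {a..b}) = 0"
  obtains \<phi> where "test_function a b \<phi>" "deriv \<phi> = f"
proof -
  have "\<exists>F. \<forall>x. - \<infinity> < ereal x \<longrightarrow> ereal x < \<infinity> \<longrightarrow> (F has_vector_derivative f x) (at x)"
    using f by (intro einterval_antiderivative) (auto simp: continuous_on_eq_continuous_at)
  then obtain F where F: "\<And>x. (F has_vector_derivative f x) (at x)"
    by auto
  have left: "F x = F a" if "x < lo" for x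
  proof -
    have "(F has_vector_derivative 0) (at y within {..<lo})" if "y \<in> {..<lo}" for y
      using F[of y] supp(4)[of y] that by (auto intro: has_vector_derivative_at_within)
    then obtain c where "\<And>x. x \<in> {..<lo} \<Longrightarrow> F x = c"
      using has_vector_derivative_zero_constant[of "{..<lo}" F] by auto
    then show ?thesis using that supp by auto
  qed
  have right: "F x = F b" if "hi < x" for x
  proof -
    have "(F has_vector_derivative 0) (at y within {hi<..})" if "y \<in> {hi<..}" for y
      using F[of y] supp(4)[of y] that by (auto intro: has_vector_derivative_at_within)
    then obtain c where "\<And>x. x \<in> {hi<..} \<Longrightarrow> F x = c"
      using has_vector_derivative_zero_constant[of "{hi<..}" F] by auto
    then show ?thesis using that supp by auto
  qed
  have "continuous_on {a..b} f"
    using f by (rule continuous_on_subset) simp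
  moreover have "(f has_integral (F b - F a)) {a..b}"
    using F supp by (intro fundamental_theorem_of_calculus) (auto intro: has_vector_derivative_at_within)
  ultimately have FF: "F b = F a"
    using int by (simp add: lebesgue_integral_eq_integral integral_unique continuous_imp_integrable_real)
  define \<phi> where "\<phi> = (\<lambda>x. F x - F a)"
  have \<phi>: "(\<phi> has_vector_derivative f x) (at x)" for x
    unfolding \<phi>_def using has_vector_derivative_diff[OF F[of x] has_vector_derivative_const[of "F a"]] by simp
  have "test_function a b \<phi>"
    unfolding test_function_def
  proof (intro conjI exI)
    show "\<phi> C1_differentiable_on UNIV"
      unfolding C1_differentiable_on_def using \<phi> f by blast
    show "compact {lo..hi}" by simp
    show "{lo..hi} \<subseteq> {a<..<b}" using supp by auto
    show "\<forall>x. x \<notin> {lo..hi} \<longrightarrow> \<phi> x = 0"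
      using left right FF by (auto simp: \<phi>_def not_le)
  qed
  moreover have "deriv \<phi> = f"
    using \<phi> by (auto intro!: DERIV_imp_deriv simp: has_real_derivative_iff_has_vector_derivative)
  ultimately show ?thesis by (rule that)
qed

text \<open>A continuous approximation of the indicator function of \<open>{s<..<t}\<close>. The summand \<open>- 1\<close> keeps its
  support at distance \<open>1 / k\<close> from the end points, so that it can serve as (the derivative of) a test
  function.\<close>

definition trapezoid :: "real \<Rightarrow> real \<Rightarrow> nat \<Rightarrow> real \<Rightarrow> real" where
  "trapezoid s t k y = max 0 (min 1 (real k * min (y - s) (t - y) - 1))"

lemma continuous_trapezoid: "continuous_on S (trapezoid s t k)"
  unfolding trapezoid_def by (intro continuous_intros)

lemma trapezoid_bounds: "\<bar>trapezoid s t k y\<bar> \<le> 1"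
  unfolding trapezoid_def by auto

lemma trapezoid_support:
  assumes "0 < k" "y \<notin> {s + 1 / real k..t - 1 / real k}"
  shows "trapezoid s t k y = 0"
proof -
  have "min (y - s) (t - y) \<le> 1 / real k"
    using assms(2) by auto
  then have "real k * min (y - s) (t - y) \<le> 1"
    using assms(1) by (simp add: pos_le_divide_eq mult.commute)
  then show ?thesis by (simp add: trapezoid_def)
qed

lemma trapezoid_tendsto: "(\<lambda>k. trapezoid s t k y) \<longlonglongrightarrow> indicator {s<..<t} y"
proof (cases "y \<in> {s<..<t}")
  case True
  define m where "m = min (y - s) (t - y)"
  have m: "0 < m" using True by (auto simp: m_def)
  obtain N :: nat where N: "2 / m \<le> real N" using real_arch_simple by blast
  have "trapezoid s t k y = 1" if "k \<ge> N" for k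
  proof -
    have "2 / m \<le> real k" using N that by linarith
    then have "2 \<le> real k * m" using m by (simp add: pos_divide_le_eq)
    then show ?thesis by (simp add: trapezoid_def m_def)
  qed
  then have "\<forall>\<^sub>F k in sequentially. trapezoid s t k y = indicator {s<..<t} y"
    using True by (auto simp: eventually_sequentially)
  then show ?thesis by (rule tendsto_eventually)
next
  case False
  have "trapezoid s t k y = 0" for k
  proof -
    have "min (y - s) (t - y) \<le> 0" using False by auto
    then have "real k * min (y - s) (t - y) \<le> 0" by (simp add: mult_nonneg_nonpos)
    then show ?thesis by (simp add: trapezoid_def)
  qed
  then show ?thesis using False by simp
qed

lemma integral_trapezoid_tendsto:
  fixes w :: "real \<Rightarrow> 'c::euclidean_space"
  assumes w: "integrable (lebesgue_on {a..b}) w" and x: "x \<le> b"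
  shows "(\<lambda>k. \<integral>y. trapezoid a x k y *\<^sub>R w y \<partial>lebesgue_on {a..b}) \<longlonglongrightarrow> (\<integral>y. w y \<partial>lebesgue_on {a..x})"
proof -
  let ?M = "lebesgue_on {a..b}"
  have [measurable]: "trapezoid a x k \<in> borel_measurable ?M" for k
    by (auto intro: continuous_imp_measurable_on_sets_lebesgue continuous_trapezoid)
  have wm [measurable]: "w \<in> borel_measurable ?M" using w by auto
  have [measurable]: "{a<..<x} \<inter> {a..b} \<in> sets ?M"
    by (rule sets_restrict_space_iff[THEN iffD2]) auto
  have ind: "(\<lambda>y. indicat_real {a<..<x} y *\<^sub>R w y) \<in> borel_measurable ?M"
  proof -
    have "(\<lambda>y. indicat_real ({a<..<x} \<inter> {a..b}) y *\<^sub>R w y) \<in> borel_measurable ?M"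
      by measurable
    also have "?this \<longleftrightarrow> ?thesis"
      by (rule measurable_lebesgue_cong) (auto simp: indicator_def)
    finally show ?thesis .
  qed
  have "(\<lambda>k. \<integral>y. trapezoid a x k y *\<^sub>R w y \<partial>?M) \<longlonglongrightarrow> (\<integral>y. indicat_real {a<..<x} y *\<^sub>R w y \<partial>?M)"
  proof (rule integral_dominated_convergence)
    show "integrable ?M (\<lambda>y. norm (w y))" using w by simp
    show "AE y in ?M. (\<lambda>k. trapezoid a x k y *\<^sub>R w y) \<longlonglongrightarrow> indicat_real {a<..<x} y *\<^sub>R w y"
      by (intro AE_I2 tendsto_intros trapezoid_tendsto)
    show "AE y in ?M. norm (trapezoid a x k y *\<^sub>R w y) \<le> norm (w y)" for k
      by (intro AE_I2) (simp add: mult_left_le_one_le trapezoid_bounds)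
  qed (use ind in measurable)
  also have "(\<integral>y. indicat_real {a<..<x} y *\<^sub>R w y \<partial>?M) = (\<integral>y. (if y \<in> {a<..<x} then w y else 0) \<partial>?M)"
    by (rule Bochner_Integration.integral_cong) (auto simp: indicator_def)
  also have "\<dots> = (\<integral>y. w y \<partial>lebesgue_on {a<..<x})"
    using x by (intro integral_restrict) auto
  also have "\<dots> = (\<integral>y. w y \<partial>lebesgue_on {a..x})"
  proof -
    have 1: "integrable (lebesgue_on {a..x}) w"
      using integrable_subinterval[OF w] x by simp
    then have "set_integrable lebesgue {a..x} w"
      by (simp add: set_integrable_def integrable_restrict_space)
    then have "set_integrable lebesgue {a<..<x} w"
      by (rule set_integrable_subset) auto
    then have 2: "integrable (lebesgue_on {a<..<x}) w"
      by (simp add: set_integrable_def integrable_restrict_space)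
    show ?thesis
      using 1 2 by (simp add: lebesgue_integral_eq_integral integral_open_interval_real)
  qed
  finally show ?thesis .
qed

text \<open>Subtracting a multiple of one fixed bump from a trapezoid makes its mean zero, so it becomes the
  derivative of a test function. The hypothesis then says that integration against trapezoids does not
  distinguish \<open>w\<close> from a constant \<open>c\<close>, and in the limit \<open>w - c\<close> has integral zero over every
  interval starting at \<open>a\<close>.\<close>

lemma du_Bois_Reymond:
  fixes w :: "real \<Rightarrow> 'c::euclidean_space"
  assumes ab: "a < b" and w: "integrable (lebesgue_on {a..b}) w"
    and zero: "\<And>\<phi>. test_function a b \<phi> \<Longrightarrow> (\<integral>x. deriv \<phi> x *\<^sub>R w x \<partial>lebesgue_on {a..b}) = 0"
  obtains c where "ae_eq a b w (\<lambda>x. c)"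
proof -
  let ?M = "lebesgue_on {a..b}"
  have int_trap: "integrable ?M (\<lambda>y. trapezoid a x k y *\<^sub>R v y)" if "integrable ?M v" for x k and v :: "real \<Rightarrow> 'e::euclidean_space"
  proof (rule Bochner_Integration.integrable_bound[OF that])
    have [measurable]: "trapezoid a x k \<in> borel_measurable ?M" "v \<in> borel_measurable ?M"
      using that by (auto intro: continuous_imp_measurable_on_sets_lebesgue continuous_trapezoid)
    show "(\<lambda>y. trapezoid a x k y *\<^sub>R v y) \<in> borel_measurable ?M" by measurable
    show "AE y in ?M. norm (trapezoid a x k y *\<^sub>R v y) \<le> norm (v y)"
      by (intro AE_I2) (simp add: mult_left_le_one_le trapezoid_bounds)
  qed
  define I where "I x k = (\<integral>y. trapezoid a x k y \<partial>?M)" for x k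
  define J where "J x k = (\<integral>y. trapezoid a x k y *\<^sub>R w y \<partial>?M)" for x k
  have "(\<lambda>k. I b k) \<longlonglongrightarrow> b - a"
    using integral_trapezoid_tendsto[of a b "\<lambda>y. 1::real" b] ab by (simp add: I_def)
  then have "\<forall>\<^sub>F k in sequentially. 0 < I b k"
    using ab by (intro order_tendstoD(1)) auto
  then have "\<forall>\<^sub>F k in sequentially. 0 < I b k \<and> 0 < k"
    using eventually_gt_at_top[of 0] by eventually_elim simp
  then obtain K where K: "0 < I b K" "0 < K"
    using eventually_happens by force
  \<comment> \<open>The mean of \<open>w\<close> against the bump \<open>trapezoid a b K\<close>, which has nonzero integral.\<close>
  define c where "c = J b K /\<^sub>R I b K"
  have key: "J x k = I x k *\<^sub>R c" if x: "a \<le> x" "x \<le> b" and k: "0 < k" for x k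
  proof -
    define f where "f y = I b K * trapezoid a x k y - I x k * trapezoid a b K y" for y
    \<comment> \<open>Both trapezoids vanish outside \<open>{a + d..b - d}\<close>; the last bound makes this interval nonempty.\<close>
    define d where "d = min (min (1 / real k) (1 / real K)) ((b - a) / 2)"
    have d: "0 < d" "d \<le> 1 / real k" "d \<le> 1 / real K" "d \<le> (b - a) / 2"
      using k K ab unfolding d_def by (simp, simp, simp, intro min.cobounded2)
    have itr: "integrable ?M (trapezoid a x' k')" for x' k'
      using int_trap[of "\<lambda>y. 1::real" x' k'] by simp
    obtain \<phi> where \<phi>: "test_function a b \<phi>" "deriv \<phi> = f"
    proof (rule test_function_antiderivative[of f a "a + d" "b - d" b])
      show "continuous_on UNIV f"
        unfolding f_def by (intro continuous_intros continuous_trapezoid)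
      show "a + d \<le> b - d" using d by (simp add: field_simps)
      show "f y = 0" if "y \<notin> {a + d..b - d}" for y
      proof -
        have "trapezoid a x k y = 0"
          using that d x k by (intro trapezoid_support) auto
        moreover have "trapezoid a b K y = 0"
          using that d K by (intro trapezoid_support) auto
        ultimately show ?thesis by (simp add: f_def)
      qed
      show "(\<integral>y. f y \<partial>?M) = 0"
        unfolding f_def using itr by (simp add: I_def)
    qed (use d in auto)
    have "0 = (\<integral>y. f y *\<^sub>R w y \<partial>?M)"
      using zero[OF \<phi>(1)] \<phi>(2) by simp
    also have "\<dots> = (\<integral>y. I b K *\<^sub>R (trapezoid a x k y *\<^sub>R w y) - I x k *\<^sub>R (trapezoid a b K y *\<^sub>R w y) \<partial>?M)"
      by (simp add: f_def algebra_simps)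
    also have "\<dots> = I b K *\<^sub>R J x k - I x k *\<^sub>R J b K"
      unfolding J_def by (simp only: Bochner_Integration.integral_diff integrable_scaleR_right int_trap[OF w]
          integral_scaleR_right)
    finally have "I b K *\<^sub>R J x k = I x k *\<^sub>R J b K" by simp
    then have "inverse (I b K) *\<^sub>R (I b K *\<^sub>R J x k) = inverse (I b K) *\<^sub>R (I x k *\<^sub>R J b K)" by simp
    then show ?thesis using K by (simp add: c_def)
  qed
  have "AE x in ?M. w x - c = 0"
  proof (rule integral_ivl_zero_imp_ae_zero)
    fix x assume x: "a \<le> x" "x \<le> b"
    have "(\<lambda>k. \<integral>y. trapezoid a x k y *\<^sub>R (w y - c) \<partial>?M) \<longlonglongrightarrow> (\<integral>y. w y - c \<partial>lebesgue_on {a..x})"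
      using w x by (intro integral_trapezoid_tendsto) auto
    moreover have "(\<lambda>k. \<integral>y. trapezoid a x k y *\<^sub>R (w y - c) \<partial>?M) \<longlonglongrightarrow> 0"
    proof (rule tendsto_eventually)
      show "\<forall>\<^sub>F k in sequentially. (\<integral>y. trapezoid a x k y *\<^sub>R (w y - c) \<partial>?M) = 0"
        using eventually_gt_at_top[of 0]
      proof eventually_elim
        case (elim k)
        have "(\<integral>y. trapezoid a x k y *\<^sub>R (w y - c) \<partial>?M) = (\<integral>y. trapezoid a x k y *\<^sub>R w y - trapezoid a x k y *\<^sub>R c \<partial>?M)"
          by (simp add: algebra_simps)
        also have "\<dots> = J x k - I x k *\<^sub>R c"
          using int_trap[OF w, of x k] int_trap[of "\<lambda>y. 1::real" x k] by (simp add: J_def I_def)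
        finally show ?case using key[OF x elim] by simp
      qed
    qed
    ultimately show "(\<integral>y. w y - c \<partial>lebesgue_on {a..x}) = 0"
      by (rule LIMSEQ_unique)
  qed (use w in auto)
  then have "ae_eq a b w (\<lambda>x. c)"
    by (simp add: ae_eq_def)
  then show ?thesis by (rule that)
qed

text \<open>In one dimension a function is weakly differentiable iff it is the indefinite integral of its weak
  derivative up to a constant. This replaces the definition by test functions in everything that
  follows.\<close>

lemma has_weak_deriv_iff:
  fixes u g :: "real \<Rightarrow> 'a::euclidean_space"
  assumes ab: "a < b"
  shows "has_weak_deriv a b u g \<longleftrightarrow>
    g \<in> L2 a b \<and> (\<exists>c. ae_eq a b u (\<lambda>x. c + (\<integral>\<theta>. g \<theta> \<partial>lebesgue_on {a..x})))"
proof
  assume ug: "has_weak_deriv a b u g"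
  then have L2: "u \<in> L2 a b" "g \<in> L2 a b" by (auto simp: has_weak_deriv_def)
  let ?P = "\<lambda>x. \<integral>\<theta>. g \<theta> \<partial>lebesgue_on {a..x}" and ?M = "lebesgue_on {a..b}"
  have P: "has_weak_deriv a b ?P g"
    using ab L2 by (intro has_weak_deriv_primitive[where c = 0]) (auto intro: ae_eqI)
  then have PL2: "?P \<in> L2 a b" by (simp add: has_weak_deriv_def)
  have scaled: "integrable ?M (\<lambda>x. deriv \<phi> x *\<^sub>R v x)" if tf: "test_function a b \<phi>" and v: "v \<in> L2 a b"
    for \<phi> and v :: "real \<Rightarrow> 'a"
  proof -
    obtain D where D: "continuous_on UNIV D" "deriv \<phi> = D"
      using test_functionE[OF tf] by blast
    then have cont: "continuous_on {a..b} D" using continuous_on_subset by blast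
    then have "bounded (D ` {a..b})"
      by (intro compact_imp_bounded compact_continuous_image) simp_all
    then obtain C where C: "\<And>x. x \<in> {a..b} \<Longrightarrow> norm (D x) \<le> C"
      unfolding bounded_iff by blast
    have [measurable]: "D \<in> borel_measurable ?M" "v \<in> borel_measurable ?M"
      using cont v by (auto intro: continuous_imp_measurable_on_sets_lebesgue L2_measurable)
    have "integrable ?M (\<lambda>x. D x *\<^sub>R v x)"
    proof (rule Bochner_Integration.integrable_bound)
      show "integrable ?M (\<lambda>x. C *\<^sub>R v x)" using L2_integrable[OF v] by simp
      show "AE x in ?M. norm (D x *\<^sub>R v x) \<le> norm (C *\<^sub>R v x)"
        using C by (intro AE_I2) (force intro!: mult_right_mono)
    qed measurable
    then show ?thesis using D by simp
  qed
  obtain c where "ae_eq a b (\<lambda>x. u x - ?P x) (\<lambda>x. c)"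
  proof (rule du_Bois_Reymond[OF ab])
    show "integrable ?M (\<lambda>x. u x - ?P x)"
      using L2 PL2 by (intro L2_integrable L2_diff)
    show "(\<integral>x. deriv \<phi> x *\<^sub>R (u x - ?P x) \<partial>?M) = 0" if "test_function a b \<phi>" for \<phi>
      using scaled[OF that L2(1)] scaled[OF that PL2] ug P that
      by (simp add: scaleR_diff_right has_weak_deriv_def)
  qed
  then have "ae_eq a b u (\<lambda>x. c + ?P x)"
    unfolding ae_eq_def by eventually_elim (simp add: algebra_simps)
  with L2 show "g \<in> L2 a b \<and> (\<exists>c. ae_eq a b u (\<lambda>x. c + ?P x))" by blast
next
  assume "g \<in> L2 a b \<and> (\<exists>c. ae_eq a b u (\<lambda>x. c + (\<integral>\<theta>. g \<theta> \<partial>lebesgue_on {a..x})))"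
  then show "has_weak_deriv a b u g"
    using has_weak_deriv_primitive ab by (metis less_imp_le)
qed

section \<open>Representatives of weak derivatives and boundary values\<close>

lemma integral_ae_eq_subinterval:
  fixes g g' :: "real \<Rightarrow> 'c::euclidean_space"
  assumes "ae_eq a b g g'" "integrable (lebesgue_on {a..b}) g" "integrable (lebesgue_on {a..b}) g'" "x \<le> b"
  shows "(\<integral>\<theta>. g \<theta> \<partial>lebesgue_on {a..x}) = (\<integral>\<theta>. g' \<theta> \<partial>lebesgue_on {a..x})"
proof (rule integral_cong_AE)
  have "integrable (lebesgue_on {a..x}) g" "integrable (lebesgue_on {a..x}) g'"
    using integrable_subinterval[OF assms(2)] integrable_subinterval[OF assms(3)] assms(4) by simp_all
  then show "g \<in> borel_measurable (lebesgue_on {a..x})" "g' \<in> borel_measurable (lebesgue_on {a..x})"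
    by auto
  have "AE \<theta> in lebesgue. \<theta> \<in> {a..b} \<longrightarrow> g \<theta> = g' \<theta>"
    using assms(1) unfolding ae_eq_def by (subst (asm) AE_restrict_space_iff) auto
  then have "AE \<theta> in lebesgue. \<theta> \<in> {a..x} \<longrightarrow> g \<theta> = g' \<theta>"
    by eventually_elim (use assms(4) in auto)
  then show "AE \<theta> in lebesgue_on {a..x}. g \<theta> = g' \<theta>"
    by (subst AE_restrict_space_iff) auto
qed

lemma has_weak_deriv_ae_cong:
  assumes ab: "a < b" and "ae_eq a b u u'" "ae_eq a b g g'" "has_weak_deriv a b u g"
  shows "has_weak_deriv a b u' g'"
proof -
  obtain c where g: "g \<in> L2 a b" and u: "ae_eq a b u (\<lambda>x. c + (\<integral>\<theta>. g \<theta> \<partial>lebesgue_on {a..x}))"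
    using assms(4) by (auto simp: has_weak_deriv_iff[OF ab])
  have g': "g' \<in> L2 a b" using assms(3) g by (rule L2_ae_cong)
  have "ae_eq a b u' (\<lambda>x. c + (\<integral>\<theta>. g' \<theta> \<partial>lebesgue_on {a..x}))"
  proof (rule ae_eq_trans[OF ae_eq_trans[OF ae_eq_sym[OF assms(2)] u] ae_eqI])
    fix x assume "a \<le> x" "x \<le> b"
    then show "c + (\<integral>\<theta>. g \<theta> \<partial>lebesgue_on {a..x}) = c + (\<integral>\<theta>. g' \<theta> \<partial>lebesgue_on {a..x})"
      using integral_ae_eq_subinterval[OF assms(3)] L2_integrable[OF g] L2_integrable[OF g'] by simp
  qed
  then show ?thesis using g' by (auto simp: has_weak_deriv_iff[OF ab])
qed

lemma continuous_ae_eq_imp_eq: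
  fixes f g :: "real \<Rightarrow> 'c::euclidean_space"
  assumes "a < b" "continuous_on {a..b} f" "continuous_on {a..b} g" "ae_eq a b f g" "x \<in> {a..b}"
  shows "f x = g x"
proof -
  have "(\<integral>y. norm (f y - g y) \<partial>lebesgue_on {a..b}) = 0"
    using assms(4) unfolding ae_eq_def by (intro integral_eq_zero_AE) (auto elim!: eventually_mono)
  moreover have "continuous_on {a..b} (\<lambda>y. norm (f y - g y))"
    using assms by (intro continuous_intros)
  ultimately have "norm (f x - g x) = 0"
    using integralL_eq_0_iff[of a b "\<lambda>y. norm (f y - g y)"] assms(1,5) by simp
  then show ?thesis by simp
qed

lemma has_weak_deriv_unique:
  assumes ab: "a < b" and "has_weak_deriv a b u g" "has_weak_deriv a b u g'"
  shows "ae_eq a b g g'"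
proof -
  let ?P = "\<lambda>g x. \<integral>\<theta>. g \<theta> \<partial>lebesgue_on {a..x}"
  obtain c where g: "g \<in> L2 a b" and u: "ae_eq a b u (\<lambda>x. c + ?P g x)"
    using assms(2) by (auto simp: has_weak_deriv_iff[OF ab])
  obtain c' where g': "g' \<in> L2 a b" and u': "ae_eq a b u (\<lambda>x. c' + ?P g' x)"
    using assms(3) by (auto simp: has_weak_deriv_iff[OF ab])
  note int = L2_integrable[OF g] L2_integrable[OF g']
  have eq: "c + ?P g x = c' + ?P g' x" if "x \<in> {a..b}" for x
  proof (rule continuous_ae_eq_imp_eq[OF ab _ _ _ that])
    show "ae_eq a b (\<lambda>x. c + ?P g x) (\<lambda>x. c' + ?P g' x)"
      using ae_eq_trans[OF ae_eq_sym[OF u] u'] .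
  qed (use int in \<open>auto intro!: continuous_intros indefinite_integral_continuous_real\<close>)
  \<comment> \<open>Evaluation at \<open>a\<close> separates the constants from the integrals.\<close>
  have "?P h a = 0" for h :: "real \<Rightarrow> 'a"
    by (rule integral_eq_zero_null_sets) simp
  then have "c = c'" using eq[of a] ab by simp
  have "AE x in lebesgue_on {a..b}. g x - g' x = 0"
  proof (rule integral_ivl_zero_imp_ae_zero)
    fix x assume x: "a \<le> x" "x \<le> b"
    then have "integrable (lebesgue_on {a..x}) g" "integrable (lebesgue_on {a..x}) g'"
      using integrable_subinterval[OF int(1)] integrable_subinterval[OF int(2)] by simp_all
    then show "?P (\<lambda>x. g x - g' x) x = 0"
      using eq[of x] \<open>c = c'\<close> x by simp
  qed (use int in simp)
  then show ?thesis by (simp add: ae_eq_def)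
qed

lemma has_weak_deriv_dx:
  assumes "has_weak_deriv a b u g"
  shows "has_weak_deriv a b u (dx a b u)"
  unfolding dx_def by (rule someI[of "has_weak_deriv a b u", OF assms])

lemma dx_ae_eq:
  assumes "a < b" "has_weak_deriv a b u g"
  shows "ae_eq a b (dx a b u) g"
  using has_weak_deriv_unique[OF assms(1) has_weak_deriv_dx[OF assms(2)] assms(2)] .

text \<open>The predicate from which \<open>dx\<close> chooses is the same for both arguments, so that the chosen
  representatives coincide, and not merely almost everywhere.\<close>

lemma dx_cong:
  assumes "a < b" "ae_eq a b u u'"
  shows "dx a b u = dx a b u'"
proof -
  have "has_weak_deriv a b u = has_weak_deriv a b u'"
    using has_weak_deriv_ae_cong[OF assms(1) assms(2) ae_eq_refl]
      has_weak_deriv_ae_cong[OF assms(1) ae_eq_sym[OF assms(2)] ae_eq_refl] by blast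
  then show ?thesis by (simp add: dx_def)
qed

lemma dx_dx_ae_eq:
  assumes "a < b" "has_weak_deriv a b u g" "has_weak_deriv a b g h"
  shows "ae_eq a b (dx a b (dx a b u)) h"
  using dx_cong[OF assms(1) dx_ae_eq[OF assms(1,2)]] dx_ae_eq[OF assms(1,3)] by simp

lemma H2_I: "has_weak_deriv a b u g \<Longrightarrow> has_weak_deriv a b g h \<Longrightarrow> u \<in> H2 a b"
  by (auto simp: H2_def)

lemma H2_has_weak_deriv_dx:
  assumes "a < b" "u \<in> H2 a b"
  shows "has_weak_deriv a b u (dx a b u)" "has_weak_deriv a b (dx a b u) (dx a b (dx a b u))"
proof -
  obtain g h where "has_weak_deriv a b u g" "has_weak_deriv a b g h"
    using assms(2) by (auto simp: H2_def)
  then show "has_weak_deriv a b u (dx a b u)" "has_weak_deriv a b (dx a b u) (dx a b (dx a b u))"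
    using has_weak_deriv_dx has_weak_deriv_ae_cong[OF assms(1) ae_eq_sym[OF dx_ae_eq[OF assms(1)]] ae_eq_refl]
    by blast+
qed

lemma H2_L2:
  assumes "a < b" "u \<in> H2 a b"
  shows "u \<in> L2 a b" "dx a b u \<in> L2 a b" "dx a b (dx a b u) \<in> L2 a b"
  using H2_has_weak_deriv_dx[OF assms] by (auto simp: has_weak_deriv_def)

text \<open>Any weak derivatives may be used to compute the norm, not only those chosen by \<open>dx\<close>.\<close>

lemma H2_norm_square:
  assumes "a < b" "has_weak_deriv a b u g" "has_weak_deriv a b g h"
  shows "(H2_norm a b u)\<^sup>2 = (L2_norm a b u)\<^sup>2 + (L2_norm a b g)\<^sup>2 + (L2_norm a b h)\<^sup>2"
proof -
  have "u \<in> H2 a b" using assms by (auto intro: H2_I)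
  then have "L2_norm a b (dx a b u) = L2_norm a b g" "L2_norm a b (dx a b (dx a b u)) = L2_norm a b h"
    using assms L2_norm_cong[OF dx_ae_eq[OF assms(1,2)] H2_L2(2)]
      L2_norm_cong[OF dx_dx_ae_eq[OF assms] H2_L2(3)] by simp_all
  then show ?thesis by (simp add: H2_norm_def)
qed

lemma H2_norm_nonneg [simp]: "0 \<le> H2_norm a b u"
  by (simp add: H2_norm_def)

lemma H2_norm_cong:
  assumes "a < b" "ae_eq a b u u'" "u \<in> H2 a b"
  shows "H2_norm a b u = H2_norm a b u'"
  using dx_cong[OF assms(1,2)] L2_norm_cong[OF assms(2) H2_L2(1)[OF assms(1,3)]]
  by (simp add: H2_norm_def)

lemma has_weak_deriv_add_scaleR:
  assumes ab: "a < b" and "has_weak_deriv a b u g" "has_weak_deriv a b u' g'"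
  shows "has_weak_deriv a b (\<lambda>x. u x + r *\<^sub>R u' x) (\<lambda>x. g x + r *\<^sub>R g' x)"
proof -
  let ?P = "\<lambda>g x. \<integral>\<theta>. g \<theta> \<partial>lebesgue_on {a..x}"
  obtain c where g: "g \<in> L2 a b" and u: "ae_eq a b u (\<lambda>x. c + ?P g x)"
    using assms(2) by (auto simp: has_weak_deriv_iff[OF ab])
  obtain c' where g': "g' \<in> L2 a b" and u': "ae_eq a b u' (\<lambda>x. c' + ?P g' x)"
    using assms(3) by (auto simp: has_weak_deriv_iff[OF ab])
  have P: "?P (\<lambda>x. g x + r *\<^sub>R g' x) x = ?P g x + r *\<^sub>R ?P g' x" if "x \<in> {a..b}" for x
  proof -
    have "integrable (lebesgue_on {a..x}) g" "integrable (lebesgue_on {a..x}) g'"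
      using integrable_subinterval[OF L2_integrable[OF g]] integrable_subinterval[OF L2_integrable[OF g']] that
      by simp_all
    then show ?thesis by simp
  qed
  have "AE x in lebesgue_on {a..b}. x \<in> {a..b}" by (rule AE_I2) simp
  then have "ae_eq a b (\<lambda>x. u x + r *\<^sub>R u' x) (\<lambda>x. (c + r *\<^sub>R c') + ?P (\<lambda>x. g x + r *\<^sub>R g' x) x)"
    using u u' unfolding ae_eq_def by eventually_elim (simp add: P algebra_simps)
  moreover have "(\<lambda>x. g x + r *\<^sub>R g' x) \<in> L2 a b"
    using g g' by (intro L2_add L2_scaleR)
  ultimately show ?thesis by (auto simp: has_weak_deriv_iff[OF ab])
qed

lemma cont_rep_eq:
  fixes h :: "real \<Rightarrow> 'c::euclidean_space"
  assumes "a < b" "continuous_on {a..b} h" "ae_eq a b f h" "x \<in> {a..b}"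
  shows "cont_rep a b f x = h x"
proof -
  have "continuous_on {a..b} (cont_rep a b f) \<and> ae_eq a b (cont_rep a b f) f"
    unfolding cont_rep_def by (rule someI[of _ h]) (use assms ae_eq_sym in blast)
  then show ?thesis
    using assms by (intro continuous_ae_eq_imp_eq[of a b]) (auto intro: ae_eq_trans)
qed

section \<open>The kernels of the operators as block matrices\<close>

definition top_block :: "'c ^ ('m::finite + 'k::finite) \<Rightarrow> 'c ^ 'm" where
  "top_block z = (\<chi> i. z $ Inl i)"

definition bot_block :: "'c ^ ('m::finite + 'k::finite) \<Rightarrow> 'c ^ 'k" where
  "bot_block z = (\<chi> i. z $ Inr i)"

lemma vstack_blocks [simp]: "top_block z \<triangleright> bot_block z = z"
  by (auto simp: vstack_def top_block_def bot_block_def vec_eq_iff split: sum.split)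

lemma top_block_vstack [simp]: "top_block (c \<triangleright> d) = c"
  by (simp add: vstack_def top_block_def vec_eq_iff)

lemma bot_block_vstack [simp]: "bot_block (c \<triangleright> d) = d"
  by (simp add: vstack_def bot_block_def vec_eq_iff)

lemma linear_top_block: "linear (top_block :: real ^ ('m::finite + 'k::finite) \<Rightarrow> _)"
  by (rule linearI) (simp_all add: top_block_def vec_eq_iff)

lemma linear_bot_block: "linear (bot_block :: real ^ ('m::finite + 'k::finite) \<Rightarrow> _)"
  by (rule linearI) (simp_all add: bot_block_def vec_eq_iff)

lemma vstack_add: "(c \<triangleright> d) + (c' \<triangleright> d') = (c + c') \<triangleright> (d + d')"
  by (auto simp: vstack_def vec_eq_iff split: sum.split)

lemma vstack_scaleR: "r *\<^sub>R (c \<triangleright> d) = (r *\<^sub>R c) \<triangleright> (r *\<^sub>R d)"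
  by (auto simp: vstack_def vec_eq_iff split: sum.split)

lemma vstack_mult_vector: "(M \<triangleright> N) *v x = (M *v x) \<triangleright> (N *v x)"
  by (auto simp: vstack_def matrix_vector_mult_def vec_eq_iff split: sum.split)

lemma hstack_mult_vstack: "hstack M N *v (c \<triangleright> d) = M *v c + N *v d"
proof -
  have "(hstack M N *v (c \<triangleright> d)) $ i = (M *v c + N *v d) $ i" for i
  proof -
    have "(hstack M N *v (c \<triangleright> d)) $ i = (\<Sum>j\<in>UNIV <+> UNIV. hstack M N $ i $ j * (c \<triangleright> d) $ j)"
      by (simp add: matrix_vector_mult_def)
    also have "\<dots> = (M *v c + N *v d) $ i"
      by (subst sum.Plus) (simp_all add: matrix_vector_mult_def hstack_def vstack_def comp_def)
    finally show ?thesis .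
  qed
  then show ?thesis by (simp add: vec_eq_iff)
qed

lemma hstack_mult: "hstack M N *v z = M *v top_block z + N *v bot_block z"
  using hstack_mult_vstack[of M N "top_block z" "bot_block z"] by simp

lemma uminus_matrix_vector_mult: "(- M) *v w = - (M *v w)" for M :: "real ^ 'k ^ 'm"
  by (simp add: matrix_vector_mult_def vec_eq_iff sum_negf)

lemma linear_mult: "linear f \<Longrightarrow> linear (\<lambda>x. (M :: real ^ 'k ^ 'm) *v f x)"
  using linear_compose[of f "(*v) M"] by (simp add: comp_def)

lemma Kmat_mult: "Kmat a x *v z = top_block z + (x - a) *\<^sub>R bot_block z"
  by (simp add: Kmat_def hstack_mult scaleR_matrix_vector_assoc[symmetric])

lemma Hmat_mult:
  "Hmat a b *v z = top_block z \<triangleright> (top_block z + (b - a) *\<^sub>R bot_block z) \<triangleright> bot_block z \<triangleright> bot_block z"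
  by (simp add: Hmat_def vstack_mult_vector hstack_mult scaleR_matrix_vector_assoc[symmetric])

lemma Qmat_mult: "Qmat b \<theta> *v w = 0 \<triangleright> ((b - \<theta>) *\<^sub>R w) \<triangleright> 0 \<triangleright> w"
  by (simp add: Qmat_def vstack_mult_vector scaleR_matrix_vector_assoc[symmetric])

text \<open>The solution \<open>(u(a), u\<^sub>x(a))\<close> of the boundary condition when the pair \<open>p\<close> is \<open>\<integral> (b - \<theta>) u\<^sub>x\<^sub>x(\<theta>) d\<theta>\<close>
  and \<open>\<integral> u\<^sub>x\<^sub>x(\<theta>) d\<theta>\<close>, the two nonzero blocks of the integral of \<open>Qmat b \<theta> *v u\<^sub>x\<^sub>x \<theta>\<close>.\<close>

definition boundary_coeffs :: "real \<Rightarrow> real \<Rightarrow> real ^ ('n + 'n + 'n + 'n) ^ ('n + 'n)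
    \<Rightarrow> (real ^ 'n) \<times> (real ^ 'n) \<Rightarrow> real ^ ('n::finite + 'n)" where
  "boundary_coeffs a b B p = - (matrix_inv (B ** Hmat a b) *v (B *v (0 \<triangleright> fst p \<triangleright> 0 \<triangleright> snd p)))"

lemma linear_boundary_coeffs: "linear (boundary_coeffs a b B)"
proof -
  have "linear (\<lambda>p :: (real ^ 'n) \<times> (real ^ 'n). (0 :: real ^ 'n) \<triangleright> fst p \<triangleright> (0 :: real ^ 'n) \<triangleright> snd p)"
    by (rule linearI) (simp_all add: vstack_add vstack_scaleR)
  then have "linear (\<lambda>p. - (matrix_inv (B ** Hmat a b) *v (B *v (0 \<triangleright> fst p \<triangleright> 0 \<triangleright> snd p))))"
    by (intro linear_compose_neg linear_mult)
  then show ?thesis by (simp add: boundary_coeffs_def[abs_def])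
qed

lemma T2_mult: "T2 a b B x \<theta> *v w = Kmat a x *v boundary_coeffs a b B ((b - \<theta>) *\<^sub>R w, w)"
  by (simp add: T2_def boundary_coeffs_def Qmat_mult uminus_matrix_vector_mult matrix_vector_mul_assoc[symmetric]
      linear_neg[OF matrix_vector_mul_linear])

lemma T1_mult: "T1 a b B x \<theta> *v w = (x - \<theta>) *\<^sub>R w + T2 a b B x \<theta> *v w"
  by (simp add: T1_def matrix_vector_mult_add_rdistrib scaleR_matrix_vector_assoc[symmetric])

lemma T2_has_vector_derivative:
  fixes B :: "real ^ ('n + 'n + 'n + 'n) ^ ('n::finite + 'n)"
  shows "((\<lambda>y. T2 a b B y \<theta>) has_vector_derivative
      - (hstack 0 (mat 1) ** (matrix_inv (B ** Hmat a b) ** B ** Qmat b \<theta>))) (at x)"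
proof -
  define N where "N = matrix_inv (B ** Hmat a b) ** B ** Qmat b \<theta>"
  define E0 E1 :: "real ^ ('n + 'n) ^ 'n" where "E0 = hstack (mat 1) 0" and "E1 = hstack 0 (mat 1)"
  have "T2 a b B y \<theta> = - (E0 ** N + (y - a) *\<^sub>R (E1 ** N))" for y
    by (rule matrix_eq[THEN iffD2])
      (simp add: T2_def N_def E0_def E1_def matrix_vector_mult_diff_rdistrib uminus_matrix_vector_mult matrix_vector_mult_add_rdistrib
        scaleR_matrix_vector_assoc[symmetric] matrix_vector_mul_assoc[symmetric] Kmat_mult hstack_mult)
  moreover have "((\<lambda>y. - (E0 ** N + (y - a) *\<^sub>R (E1 ** N))) has_vector_derivative - (E1 ** N)) (at x)"
    by (auto intro!: derivative_eq_intros)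
  ultimately show ?thesis
    by (simp add: N_def E1_def)
qed

lemma dT2_mult: "vector_derivative (\<lambda>y. T2 a b B y \<theta>) (at x) *v w
    = bot_block (boundary_coeffs a b B ((b - \<theta>) *\<^sub>R w, w))"
  unfolding vector_derivative_at[OF T2_has_vector_derivative]
  by (simp add: boundary_coeffs_def Qmat_mult uminus_matrix_vector_mult matrix_vector_mul_assoc[symmetric]
      hstack_mult linear_neg[OF linear_bot_block])

lemma dT1_mult: "vector_derivative (\<lambda>y. T1 a b B y \<theta>) (at x) *v w
    = w + vector_derivative (\<lambda>y. T2 a b B y \<theta>) (at x) *v w"
proof -
  have "((\<lambda>y. T1 a b B y \<theta>) has_vector_derivative mat 1 + vector_derivative (\<lambda>y. T2 a b B y \<theta>) (at x)) (at x)"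
    unfolding T1_def vector_derivative_at[OF T2_has_vector_derivative]
    by (rule has_vector_derivative_add[OF _ T2_has_vector_derivative]) (auto intro!: derivative_eq_intros)
  then show ?thesis
    by (simp add: vector_derivative_at matrix_vector_mult_add_rdistrib)
qed

lemma integral_linear_image:
  fixes f :: "'x \<Rightarrow> 'c::euclidean_space" and T :: "'c \<Rightarrow> 'e::euclidean_space"
  assumes "linear T" "integrable M f"
  shows "integrable M (\<lambda>x. T (f x))" "(\<integral>x. T (f x) \<partial>M) = T (\<integral>x. f x \<partial>M)"
  using assms linear_conv_bounded_linear[of T]
  by (auto simp: integrable_bounded_linear integral_bounded_linear)

lemma integral_pair:
  fixes f :: "'x \<Rightarrow> 'c::euclidean_space" and g :: "'x \<Rightarrow> 'e::euclidean_space"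
  assumes "integrable M f" "integrable M g"
  shows "integrable M (\<lambda>x. (f x, g x))" "(\<integral>x. (f x, g x) \<partial>M) = (\<integral>x. f x \<partial>M, \<integral>x. g x \<partial>M)"
proof -
  have "linear (\<lambda>y::'c. (y, 0::'e))" "linear (\<lambda>y::'e. (0::'c, y))"
    by (auto intro!: linearI)
  note l = integral_linear_image(1)[OF this(1) assms(1)] integral_linear_image(1)[OF this(2) assms(2)]
  show pair: "integrable M (\<lambda>x. (f x, g x))"
    using Bochner_Integration.integrable_add[OF l] by simp
  have "linear (fst :: 'c \<times> 'e \<Rightarrow> 'c)" "linear (snd :: 'c \<times> 'e \<Rightarrow> 'e)"
    by (auto intro!: linearI)
  from integral_linear_image(2)[OF this(1) pair] integral_linear_image(2)[OF this(2) pair]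
  show "(\<integral>x. (f x, g x) \<partial>M) = (\<integral>x. f x \<partial>M, \<integral>x. g x \<partial>M)"
    by (simp add: prod_eq_iff)
qed

lemma integrable_diff_scaleR:
  fixes v :: "real \<Rightarrow> 'c::euclidean_space"
  assumes "integrable (lebesgue_on {a..b}) v"
  shows "integrable (lebesgue_on {a..b}) (\<lambda>\<theta>. (x - \<theta>) *\<^sub>R v \<theta>)"
proof (rule Bochner_Integration.integrable_bound)
  show "integrable (lebesgue_on {a..b}) (\<lambda>\<theta>. (\<bar>x - a\<bar> + \<bar>x - b\<bar>) *\<^sub>R v \<theta>)"
    using assms by simp
  have [measurable]: "v \<in> borel_measurable (lebesgue_on {a..b})" "(\<lambda>\<theta>. x - \<theta>) \<in> borel_measurable (lebesgue_on {a..b})"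
    using assms by (auto intro!: continuous_imp_measurable_on_sets_lebesgue continuous_intros)
  show "(\<lambda>\<theta>. (x - \<theta>) *\<^sub>R v \<theta>) \<in> borel_measurable (lebesgue_on {a..b})"
    by measurable
  show "AE \<theta> in lebesgue_on {a..b}. norm ((x - \<theta>) *\<^sub>R v \<theta>) \<le> norm ((\<bar>x - a\<bar> + \<bar>x - b\<bar>) *\<^sub>R v \<theta>)"
    by (intro AE_I2) (auto intro!: mult_right_mono)
qed

text \<open>The values at \<open>a\<close> of \<open>T1_op a b B v\<close> and of its derivative.\<close>

definition T1_coeffs :: "real \<Rightarrow> real \<Rightarrow> real ^ ('n + 'n + 'n + 'n) ^ ('n + 'n)
    \<Rightarrow> (real \<Rightarrow> real ^ 'n) \<Rightarrow> real ^ ('n::finite + 'n)" where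
  "T1_coeffs a b B v = boundary_coeffs a b B
     (\<integral>\<theta>. (b - \<theta>) *\<^sub>R v \<theta> \<partial>lebesgue_on {a..b}, \<integral>\<theta>. v \<theta> \<partial>lebesgue_on {a..b})"

text \<open>The continuous representative of the weak derivative of \<open>T1_op a b B v\<close>.\<close>

definition T1_dx :: "real \<Rightarrow> real \<Rightarrow> real ^ ('n + 'n + 'n + 'n) ^ ('n + 'n)
    \<Rightarrow> (real \<Rightarrow> real ^ 'n) \<Rightarrow> real \<Rightarrow> real ^ 'n::finite" where
  "T1_dx a b B v x = bot_block (T1_coeffs a b B v) + (\<integral>\<theta>. v \<theta> \<partial>lebesgue_on {a..x})"

text \<open>Both operators of the PIE have this form: a term \<open>R\<close> that is present for \<open>\<theta> \<le> x\<close> only, and a linear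
  map \<open>L\<close> of the integrands of two moments of \<open>v\<close> that is the same on both sides of the diagonal. The
  \<open>L\<close>-terms therefore add up to \<open>L\<close> of the moments over the whole interval.\<close>

lemma split_kernel_integral:
  fixes L :: "(real ^ 'n) \<times> (real ^ 'n) \<Rightarrow> 'c::euclidean_space" and R :: "real \<Rightarrow> 'c" and v :: "real \<Rightarrow> real ^ 'n"
  assumes v: "integrable (lebesgue_on {a..b}) v" and L: "linear L" and x: "a \<le> x" "x \<le> b"
    and R: "integrable (lebesgue_on {a..b}) R"
  shows "(\<integral>\<theta>. R \<theta> + L ((b - \<theta>) *\<^sub>R v \<theta>, v \<theta>) \<partial>lebesgue_on {a..x}) + (\<integral>\<theta>. L ((b - \<theta>) *\<^sub>R v \<theta>, v \<theta>) \<partial>lebesgue_on {x..b})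
    = (\<integral>\<theta>. R \<theta> \<partial>lebesgue_on {a..x})
      + L (\<integral>\<theta>. (b - \<theta>) *\<^sub>R v \<theta> \<partial>lebesgue_on {a..b}, \<integral>\<theta>. v \<theta> \<partial>lebesgue_on {a..b})"
proof -
  note pair = integral_pair[OF integrable_diff_scaleR[OF v, of b] v]
  note Lv = integral_linear_image[OF L pair(1)]
  have "integrable (lebesgue_on {a..x}) R"
    "integrable (lebesgue_on {a..x}) (\<lambda>\<theta>. L ((b - \<theta>) *\<^sub>R v \<theta>, v \<theta>))"
    using integrable_subinterval[OF R] integrable_subinterval[OF Lv(1)] x by simp_all
  then show ?thesis
    using integral_combine[OF Lv(1) x] Lv(2) pair(2) by simp
qed

text \<open>\<open>T1_op\<close> integrates twice, with the initial values that the boundary condition prescribes.\<close>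

lemma T1_op_eq_integral:
  fixes B :: "real ^ ('n + 'n + 'n + 'n) ^ ('n::finite + 'n)"
  assumes v: "v \<in> L2 a b" and x: "a \<le> x" "x \<le> b"
  shows "T1_op a b B v x = top_block (T1_coeffs a b B v) + (\<integral>y. T1_dx a b B v y \<partial>lebesgue_on {a..x})"
proof -
  note vi = L2_integrable[OF v]
  let ?z = "T1_coeffs a b B v"
  have "T1_op a b B v x = (\<integral>\<theta>. (x - \<theta>) *\<^sub>R v \<theta> \<partial>lebesgue_on {a..x}) + Kmat a x *v ?z"
    unfolding T1_op_def T1_mult T2_mult T1_coeffs_def
    by (rule split_kernel_integral[OF vi _ x integrable_diff_scaleR[OF vi]])
      (intro linear_mult linear_boundary_coeffs)
  also have "(\<integral>\<theta>. (x - \<theta>) *\<^sub>R v \<theta> \<partial>lebesgue_on {a..x}) = (\<integral>y. (\<integral>\<theta>. v \<theta> \<partial>lebesgue_on {a..y}) \<partial>lebesgue_on {a..x})"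
    using integral_integral_eq[OF vi x] ..
  also have "(\<integral>y. (\<integral>\<theta>. v \<theta> \<partial>lebesgue_on {a..y}) \<partial>lebesgue_on {a..x}) + Kmat a x *v ?z
      = top_block ?z + (\<integral>y. T1_dx a b B v y \<partial>lebesgue_on {a..x})"
  proof -
    have "continuous_on {a..x} (\<lambda>y. \<integral>\<theta>. v \<theta> \<partial>lebesgue_on {a..y})"
      using indefinite_integral_continuous_real[OF vi] by (rule continuous_on_subset) (use x in auto)
    then have "integrable (lebesgue_on {a..x}) (\<lambda>y. \<integral>\<theta>. v \<theta> \<partial>lebesgue_on {a..y})"
      by (rule continuous_imp_integrable_real)
    then show ?thesis
      using x by (simp add: T1_dx_def Kmat_mult)
  qed
  finally show ?thesis .
qed

text \<open>The kernels \<open>A1\<close> and \<open>A2\<close> apply \<open>A x\<close> to those of \<open>T1_op\<close> and of its derivative, and \<open>A x\<close>, being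
  linear, may be taken out of the integrals.\<close>

lemma A11_op_eq:
  fixes B :: "real ^ ('n + 'n + 'n + 'n) ^ ('n::finite + 'n)"
    and A :: "real \<Rightarrow> real ^ ('n + 'n + 'n) ^ 'n"
  assumes v: "v \<in> L2 a b" and x: "a \<le> x" "x \<le> b"
  shows "A11_op a b A B v x = A x *v (T1_op a b B v x \<triangleright> T1_dx a b B v x \<triangleright> v x)"
proof -
  note vi = L2_integrable[OF v]
  \<comment> \<open>\<open>R\<close> acts on pairs (value, derivative); \<open>L\<close> applies it to the part of the kernels that comes from
    the initial values and is the same on both sides of the diagonal.\<close>
  define R :: "(real ^ 'n) \<times> (real ^ 'n) \<Rightarrow> real ^ 'n" where "R q = A x *v (fst q \<triangleright> snd q \<triangleright> 0)" for q
  have R: "linear R"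
    unfolding R_def by (intro linear_mult) (rule linearI, simp_all add: vstack_add vstack_scaleR)
  define L where "L q = R (Kmat a x *v boundary_coeffs a b B q, bot_block (boundary_coeffs a b B q))" for q
  have "linear (\<lambda>q. Kmat a x *v boundary_coeffs a b B q)"
    by (intro linear_mult linear_boundary_coeffs)
  moreover have "linear (\<lambda>q. bot_block (boundary_coeffs a b B q))"
    using linear_compose[OF linear_boundary_coeffs linear_bot_block] by (simp add: comp_def)
  ultimately have "linear (\<lambda>q. (Kmat a x *v boundary_coeffs a b B q, bot_block (boundary_coeffs a b B q)))"
    unfolding linear_iff by simp
  then have L: "linear L"
    unfolding L_def using linear_compose[OF _ R] by (simp add: comp_def)
  have blocks: "(A x ** (P \<triangleright> Q \<triangleright> 0)) *v w = R (P *v w, Q *v w)" for P Q :: "real ^ 'n ^ 'n" and w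
    by (simp add: R_def matrix_vector_mul_assoc[symmetric] vstack_mult_vector)
  have A2: "A2 a b A B x \<theta> *v w = L ((b - \<theta>) *\<^sub>R w, w)" for \<theta> w
    by (simp add: A2_def blocks L_def T2_mult dT2_mult)
  have A1: "A1 a b A B x \<theta> *v w = R ((x - \<theta>) *\<^sub>R w, w) + L ((b - \<theta>) *\<^sub>R w, w)" for \<theta> w
    by (simp add: A1_def blocks L_def T1_mult T2_mult dT1_mult dT2_mult linear_add[OF R, symmetric])
  have vx: "integrable (lebesgue_on {a..x}) v"
    using integrable_subinterval[OF vi] x by simp
  note pair = integral_pair[OF integrable_diff_scaleR[OF vi, of x] vi]
  note pairx = integral_pair[OF integrable_diff_scaleR[OF vx, of x] vx]
  have "(\<integral>\<theta>. A1 a b A B x \<theta> *v v \<theta> \<partial>lebesgue_on {a..x}) + (\<integral>\<theta>. A2 a b A B x \<theta> *v v \<theta> \<partial>lebesgue_on {x..b})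
    = (\<integral>\<theta>. R ((x - \<theta>) *\<^sub>R v \<theta>, v \<theta>) \<partial>lebesgue_on {a..x})
      + L (\<integral>\<theta>. (b - \<theta>) *\<^sub>R v \<theta> \<partial>lebesgue_on {a..b}, \<integral>\<theta>. v \<theta> \<partial>lebesgue_on {a..b})"
    unfolding A1 A2
    by (rule split_kernel_integral[OF vi L x integral_linear_image(1)[OF R pair(1)]])
  also have "(\<integral>\<theta>. R ((x - \<theta>) *\<^sub>R v \<theta>, v \<theta>) \<partial>lebesgue_on {a..x})
      = R (\<integral>\<theta>. (x - \<theta>) *\<^sub>R v \<theta> \<partial>lebesgue_on {a..x}, \<integral>\<theta>. v \<theta> \<partial>lebesgue_on {a..x})"
    using integral_linear_image(2)[OF R pairx(1)] pairx(2) by simp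
  also have "\<dots> + L (\<integral>\<theta>. (b - \<theta>) *\<^sub>R v \<theta> \<partial>lebesgue_on {a..b}, \<integral>\<theta>. v \<theta> \<partial>lebesgue_on {a..b})
      = R (T1_op a b B v x, T1_dx a b B v x)"
  proof -
    have "T1_op a b B v x = (\<integral>\<theta>. (x - \<theta>) *\<^sub>R v \<theta> \<partial>lebesgue_on {a..x}) + Kmat a x *v T1_coeffs a b B v"
      unfolding T1_op_def T1_mult T2_mult T1_coeffs_def
      by (rule split_kernel_integral[OF vi _ x integrable_diff_scaleR[OF vi]])
        (intro linear_mult linear_boundary_coeffs)
    then show ?thesis
      by (simp add: L_def T1_dx_def T1_coeffs_def linear_add[OF R, symmetric] add.commute)
  qed
  finally have "A11_op a b A B v x = A0 A x *v v x + R (T1_op a b B v x, T1_dx a b B v x)"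
    by (simp add: A11_op_def)
  also have "A0 A x *v v x = A x *v (0 \<triangleright> 0 \<triangleright> v x)"
    by (simp add: A0_def matrix_vector_mul_assoc[symmetric] vstack_mult_vector)
  finally show ?thesis
    by (simp add: R_def matrix_vector_right_distrib[symmetric] vstack_add)
qed

section \<open>The operator T1 as a bounded isomorphism from L2 onto X-B\<close>

text \<open>The only place where the invertibility of \<open>B ** Hmat a b\<close> enters: the boundary condition has
  exactly one solution in the initial values \<open>z\<close>.\<close>

lemma boundary_coeffs_unique:
  fixes B :: "real ^ ('n + 'n + 'n + 'n) ^ ('n::finite + 'n)"
  assumes "invertible (B ** Hmat a b)"
  shows "B *v (Hmat a b *v z + (0 \<triangleright> fst p \<triangleright> 0 \<triangleright> snd p)) = 0 \<longleftrightarrow> z = boundary_coeffs a b B p"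
proof -
  let ?M = "matrix_inv (B ** Hmat a b)" and ?q = "B *v (0 \<triangleright> fst p \<triangleright> 0 \<triangleright> snd p)"
  have "\<exists>A'. (B ** Hmat a b) ** A' = mat 1 \<and> A' ** (B ** Hmat a b) = mat 1"
    using assms by (simp add: invertible_def)
  then have inv: "(B ** Hmat a b) ** ?M = mat 1" "?M ** (B ** Hmat a b) = mat 1"
    unfolding matrix_inv_def by (metis (mono_tags, lifting) someI_ex)+
  have "B *v (Hmat a b *v z + (0 \<triangleright> fst p \<triangleright> 0 \<triangleright> snd p)) = (B ** Hmat a b) *v z + ?q"
    by (simp add: matrix_vector_right_distrib matrix_vector_mul_assoc)
  also have "\<dots> = 0 \<longleftrightarrow> z = - (?M *v ?q)"
  proof
    assume "(B ** Hmat a b) *v z + ?q = 0"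
    then have "(B ** Hmat a b) *v z = - ?q"
      by (rule eq_neg_iff_add_eq_0[THEN iffD2])
    then have "?M *v ((B ** Hmat a b) *v z) = ?M *v (- ?q)"
      by (rule arg_cong)
    then show "z = - (?M *v ?q)"
      by (simp add: matrix_vector_mul_assoc inv linear_neg[OF matrix_vector_mul_linear])
  next
    assume "z = - (?M *v ?q)"
    then have "(B ** Hmat a b) *v z = - (((B ** Hmat a b) ** ?M) *v ?q)"
      by (simp add: matrix_mul_assoc matrix_vector_mul_assoc linear_neg[OF matrix_vector_mul_linear])
    then show "(B ** Hmat a b) *v z + ?q = 0"
      by (simp add: inv)
  qed
  finally show ?thesis by (simp add: boundary_coeffs_def)
qed

lemma continuous_primitive:
  fixes g :: "real \<Rightarrow> 'c::euclidean_space"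
  assumes "integrable (lebesgue_on {a..b}) g"
  shows "continuous_on {a..b} (\<lambda>x. c + (\<integral>\<theta>. g \<theta> \<partial>lebesgue_on {a..x}))"
  using assms by (intro continuous_intros indefinite_integral_continuous_real)

lemma cont_rep_primitive:
  fixes g :: "real \<Rightarrow> 'c::euclidean_space"
  assumes "a < b" "integrable (lebesgue_on {a..b}) g" "ae_eq a b u (\<lambda>x. c + (\<integral>\<theta>. g \<theta> \<partial>lebesgue_on {a..x}))"
  shows "cont_rep a b u a = c" "cont_rep a b u b = c + (\<integral>\<theta>. g \<theta> \<partial>lebesgue_on {a..b})"
proof -
  have "(\<integral>\<theta>. g \<theta> \<partial>lebesgue_on {a..a}) = 0"
    by (rule integral_eq_zero_null_sets) simp
  then show "cont_rep a b u a = c" "cont_rep a b u b = c + (\<integral>\<theta>. g \<theta> \<partial>lebesgue_on {a..b})"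
    using cont_rep_eq[OF assms(1) continuous_primitive[OF assms(2)] assms(3)] assms(1) by auto
qed

text \<open>Boundary values of a twice integrated function: \<open>Hmat\<close> propagates the initial values \<open>(c, d)\<close> to both
  end points, and the second summand is the integral of \<open>Qmat b \<theta> *v h \<theta>\<close>.\<close>

lemma boundary_values:
  assumes ab: "a < b" and h: "h \<in> L2 a b"
    and u: "ae_eq a b u (\<lambda>x. c + (\<integral>y. d + (\<integral>\<theta>. h \<theta> \<partial>lebesgue_on {a..y}) \<partial>lebesgue_on {a..x}))"
  shows "cont_rep a b u a \<triangleright> cont_rep a b u b \<triangleright> cont_rep a b (dx a b u) a \<triangleright> cont_rep a b (dx a b u) b
    = Hmat a b *v (c \<triangleright> d) + (0 \<triangleright> (\<integral>\<theta>. (b - \<theta>) *\<^sub>R h \<theta> \<partial>lebesgue_on {a..b}) \<triangleright> 0 \<triangleright> (\<integral>\<theta>. h \<theta> \<partial>lebesgue_on {a..b}))"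
proof -
  let ?g = "\<lambda>y. d + (\<integral>\<theta>. h \<theta> \<partial>lebesgue_on {a..y})"
  note hi = L2_integrable[OF h]
  have cont: "continuous_on {a..b} ?g"
    using hi by (rule continuous_primitive)
  then have g: "?g \<in> L2 a b" by (rule continuous_L2)
  have "has_weak_deriv a b u ?g"
    using ab g u by (intro has_weak_deriv_primitive) auto
  then have "ae_eq a b (dx a b u) ?g"
    by (rule dx_ae_eq[OF ab])
  note cont_rep_primitive[OF ab hi this] cont_rep_primitive[OF ab L2_integrable[OF g] u]
  moreover have "(\<integral>y. ?g y \<partial>lebesgue_on {a..b}) = (b - a) *\<^sub>R d + (\<integral>\<theta>. (b - \<theta>) *\<^sub>R h \<theta> \<partial>lebesgue_on {a..b})"
  proof -
    have "integrable (lebesgue_on {a..b}) (\<lambda>y. \<integral>\<theta>. h \<theta> \<partial>lebesgue_on {a..y})"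
      using indefinite_integral_continuous_real[OF hi] by (rule continuous_imp_integrable_real)
    then show ?thesis
      using ab integral_integral_eq[OF hi, of b] by simp
  qed
  ultimately show ?thesis
    by (simp add: Hmat_mult vstack_add add.assoc)
qed

lemma T1_dx_L2:
  assumes "v \<in> L2 a b"
  shows "T1_dx a b B v \<in> L2 a b"
  using continuous_L2[OF continuous_primitive[OF L2_integrable[OF assms]]] by (simp add: T1_dx_def[abs_def])

lemma T1_op_ae_eq:
  assumes "v \<in> L2 a b"
  shows "ae_eq a b (T1_op a b B v)
    (\<lambda>x. top_block (T1_coeffs a b B v) + (\<integral>y. T1_dx a b B v y \<partial>lebesgue_on {a..x}))"
  using T1_op_eq_integral[OF assms] by (auto intro!: ae_eqI)

lemma T1_op_has_weak_deriv:
  assumes "a < b" "v \<in> L2 a b"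
  shows "has_weak_deriv a b (T1_op a b B v) (T1_dx a b B v)" "has_weak_deriv a b (T1_dx a b B v) v"
proof -
  show "has_weak_deriv a b (T1_op a b B v) (T1_dx a b B v)"
    using assms by (intro has_weak_deriv_primitive[OF _ _ T1_op_ae_eq] T1_dx_L2) auto
  show "has_weak_deriv a b (T1_dx a b B v) v"
    using assms unfolding T1_dx_def[abs_def] by (intro has_weak_deriv_primitive[OF _ _ ae_eq_refl]) auto
qed

lemma dx_dx_T1_op:
  assumes "a < b" "v \<in> L2 a b"
  shows "ae_eq a b (dx a b (dx a b (T1_op a b B v))) v"
  using dx_dx_ae_eq[OF assms(1) T1_op_has_weak_deriv[OF assms]] .

lemma T1_op_in_X_B:
  assumes ab: "a < b" and inv: "invertible (B ** Hmat a b)" and v: "v \<in> L2 a b"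
  shows "T1_op a b B v \<in> X_B a b B"
proof -
  let ?z = "T1_coeffs a b B v"
  have "cont_rep a b (T1_op a b B v) a \<triangleright> cont_rep a b (T1_op a b B v) b \<triangleright>
      cont_rep a b (dx a b (T1_op a b B v)) a \<triangleright> cont_rep a b (dx a b (T1_op a b B v)) b
    = Hmat a b *v (top_block ?z \<triangleright> bot_block ?z)
      + (0 \<triangleright> (\<integral>\<theta>. (b - \<theta>) *\<^sub>R v \<theta> \<partial>lebesgue_on {a..b}) \<triangleright> 0 \<triangleright> (\<integral>\<theta>. v \<theta> \<partial>lebesgue_on {a..b}))"
    using T1_op_ae_eq[OF v, of B] by (intro boundary_values[OF ab v]) (simp add: T1_dx_def[abs_def])
  then show ?thesis
    using boundary_coeffs_unique[OF inv, of ?z "(\<integral>\<theta>. (b - \<theta>) *\<^sub>R v \<theta> \<partial>lebesgue_on {a..b}, \<integral>\<theta>. v \<theta> \<partial>lebesgue_on {a..b})"]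
      H2_I[OF T1_op_has_weak_deriv[OF ab v, of B]]
    by (simp add: X_B_def T1_coeffs_def)
qed

text \<open>A function in \<open>X_B\<close> arises by integrating its second derivative twice from some initial values.
  These satisfy the boundary condition, so by uniqueness they are those that \<open>T1_op\<close> uses.\<close>

lemma T1_op_dx_dx:
  assumes ab: "a < b" and inv: "invertible (B ** Hmat a b)" and u: "u \<in> X_B a b B"
  shows "ae_eq a b (T1_op a b B (dx a b (dx a b u))) u"
proof -
  let ?P = "\<lambda>g x. \<integral>\<theta>. g \<theta> \<partial>lebesgue_on {a..x}"
  define g h where "g = dx a b u" and "h = dx a b (dx a b u)"
  have H2: "u \<in> H2 a b" using u by (simp add: X_B_def)
  have wd: "has_weak_deriv a b u g" "has_weak_deriv a b g h"
    using H2_has_weak_deriv_dx[OF ab H2] by (simp_all add: g_def h_def)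
  then have g: "g \<in> L2 a b" and h: "h \<in> L2 a b"
    by (auto simp: has_weak_deriv_def)
  obtain c where c: "ae_eq a b u (\<lambda>x. c + ?P g x)"
    using wd(1) by (auto simp: has_weak_deriv_iff[OF ab])
  obtain d where d: "ae_eq a b g (\<lambda>x. d + ?P h x)"
    using wd(2) by (auto simp: has_weak_deriv_iff[OF ab])
  have rep: "ae_eq a b u (\<lambda>x. c + ?P (\<lambda>y. d + ?P h y) x)"
  proof (rule ae_eq_trans[OF c ae_eqI])
    fix x assume "a \<le> x" "x \<le> b"
    then show "c + ?P g x = c + ?P (\<lambda>y. d + ?P h y) x"
      using integral_ae_eq_subinterval[OF d L2_integrable[OF g]]
        continuous_imp_integrable_real[OF continuous_primitive[OF L2_integrable[OF h], of d]] by simp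
  qed
  have z: "c \<triangleright> d = T1_coeffs a b B h"
    unfolding T1_coeffs_def boundary_coeffs_unique[OF inv, symmetric]
    using u boundary_values[OF ab h rep] by (simp add: X_B_def)
  have "ae_eq a b (T1_op a b B h) (\<lambda>x. c + ?P (\<lambda>y. d + ?P h y) x)"
    using T1_op_ae_eq[OF h, of B] by (simp add: z[symmetric] T1_dx_def[abs_def])
  then show ?thesis
    unfolding h_def using ae_eq_trans[OF _ ae_eq_sym[OF rep]] by (simp add: h_def)
qed

lemma A11_op_ae_eq:
  assumes ab: "a < b" and v: "v \<in> L2 a b"
  shows "ae_eq a b (A11_op a b A B v)
    (\<lambda>x. A x *v (T1_op a b B v x \<triangleright> dx a b (T1_op a b B v) x \<triangleright> dx a b (dx a b (T1_op a b B v)) x))"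
proof -
  have "AE x in lebesgue_on {a..b}. x \<in> {a..b}" by (rule AE_I2) simp
  then show ?thesis
    using dx_ae_eq[OF ab T1_op_has_weak_deriv(1)[OF ab v, of B]] dx_dx_T1_op[OF ab v, of B]
    unfolding ae_eq_def by eventually_elim (simp add: A11_op_eq[OF v])
qed

lemma T1_op_ae_cong:
  assumes "ae_eq a b v w" "v \<in> L2 a b" "w \<in> L2 a b"
  shows "ae_eq a b (T1_op a b B v) (T1_op a b B w)"
proof (rule ae_eqI)
  fix x assume x: "a \<le> x" "x \<le> b"
  note int = L2_integrable[OF assms(2)] L2_integrable[OF assms(3)]
  have "ae_eq a b (\<lambda>\<theta>. (b - \<theta>) *\<^sub>R v \<theta>) (\<lambda>\<theta>. (b - \<theta>) *\<^sub>R w \<theta>)"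
    using assms(1) unfolding ae_eq_def by eventually_elim simp
  then have "T1_coeffs a b B v = T1_coeffs a b B w"
    using integral_ae_eq_subinterval[OF _ int[THEN integrable_diff_scaleR]] integral_ae_eq_subinterval[OF assms(1) int]
    by (simp add: T1_coeffs_def)
  moreover have "T1_dx a b B v y = T1_dx a b B w y" if "y \<in> {a..x}" for y
    using integral_ae_eq_subinterval[OF assms(1) int, of y] that x calculation by (simp add: T1_dx_def)
  then have "(\<integral>y. T1_dx a b B v y \<partial>lebesgue_on {a..x}) = (\<integral>y. T1_dx a b B w y \<partial>lebesgue_on {a..x})"
    by (intro Bochner_Integration.integral_cong) auto
  ultimately show "T1_op a b B v x = T1_op a b B w x"
    using T1_op_eq_integral[OF assms(2) x] T1_op_eq_integral[OF assms(3) x] by simp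
qed

lemma T1_op_add_scaleR:
  assumes v: "v \<in> L2 a b" and w: "w \<in> L2 a b" and x: "a \<le> x" "x \<le> b"
  shows "T1_op a b B (\<lambda>\<theta>. v \<theta> + r *\<^sub>R w \<theta>) x = T1_op a b B v x + r *\<^sub>R T1_op a b B w x"
proof -
  let ?P = "\<lambda>v x. \<integral>\<theta>. v \<theta> \<partial>lebesgue_on {a..x}" and ?J = "\<lambda>v. \<integral>\<theta>. (b - \<theta>) *\<^sub>R v \<theta> \<partial>lebesgue_on {a..b}"
  note int = L2_integrable[OF v] L2_integrable[OF w]
  have P: "?P (\<lambda>\<theta>. f \<theta> + r *\<^sub>R g \<theta>) y = ?P f y + r *\<^sub>R ?P g y"
    if "integrable (lebesgue_on {a..b}) f" "integrable (lebesgue_on {a..b}) g" "y \<le> b" for f g :: "real \<Rightarrow> real ^ 'a" and y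
  proof -
    have "integrable (lebesgue_on {a..y}) f" "integrable (lebesgue_on {a..y}) g"
      using integrable_subinterval[OF that(1)] integrable_subinterval[OF that(2)] that(3) by simp_all
    then show ?thesis by simp
  qed
  have "?J (\<lambda>\<theta>. v \<theta> + r *\<^sub>R w \<theta>) = (\<integral>\<theta>. (b - \<theta>) *\<^sub>R v \<theta> + r *\<^sub>R ((b - \<theta>) *\<^sub>R w \<theta>) \<partial>lebesgue_on {a..b})"
    by (simp add: algebra_simps)
  also have "\<dots> = ?J v + r *\<^sub>R ?J w"
    using P[OF int[THEN integrable_diff_scaleR], of b b b] by simp
  finally have "(?J (\<lambda>\<theta>. v \<theta> + r *\<^sub>R w \<theta>), ?P (\<lambda>\<theta>. v \<theta> + r *\<^sub>R w \<theta>) b) = (?J v, ?P v b) + r *\<^sub>R (?J w, ?P w b)"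
    using P[OF int, of b] by simp
  then have coeffs: "T1_coeffs a b B (\<lambda>\<theta>. v \<theta> + r *\<^sub>R w \<theta>) = T1_coeffs a b B v + r *\<^sub>R T1_coeffs a b B w"
    unfolding T1_coeffs_def by (simp only: linear_add[OF linear_boundary_coeffs] linear_scale[OF linear_boundary_coeffs])
  have dx: "T1_dx a b B (\<lambda>\<theta>. v \<theta> + r *\<^sub>R w \<theta>) y = T1_dx a b B v y + r *\<^sub>R T1_dx a b B w y" if "y \<le> b" for y
    unfolding T1_dx_def coeffs using P[OF int that]
    by (simp add: linear_add[OF linear_bot_block] linear_scale[OF linear_bot_block] algebra_simps)
  have "(\<integral>y. T1_dx a b B (\<lambda>\<theta>. v \<theta> + r *\<^sub>R w \<theta>) y \<partial>lebesgue_on {a..x})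
      = (\<integral>y. T1_dx a b B v y + r *\<^sub>R T1_dx a b B w y \<partial>lebesgue_on {a..x})"
    by (rule Bochner_Integration.integral_cong) (use x dx in auto)
  also have "\<dots> = ?P (T1_dx a b B v) x + r *\<^sub>R ?P (T1_dx a b B w) x"
    using v w x by (intro P L2_integrable T1_dx_L2)
  finally show ?thesis
    using v w x by (simp add: T1_op_eq_integral L2_add L2_scaleR coeffs linear_add[OF linear_top_block]
        linear_scale[OF linear_top_block] algebra_simps)
qed

lemma L2_norm_primitive_square_le:
  assumes ab: "a \<le> b" and g: "g \<in> L2 a b"
  shows "(L2_norm a b (\<lambda>x. c + (\<integral>\<theta>. g \<theta> \<partial>lebesgue_on {a..x})))\<^sup>2
    \<le> 2 * (b - a) * (norm c)\<^sup>2 + 2 * (b - a)\<^sup>2 * (L2_norm a b g)\<^sup>2"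
proof -
  have "(L2_norm a b (\<lambda>x. c + (\<integral>\<theta>. g \<theta> \<partial>lebesgue_on {a..x})))\<^sup>2
      \<le> (b - a) * (2 * (norm c)\<^sup>2 + 2 * ((b - a) * (L2_norm a b g)\<^sup>2))"
  proof (rule L2_norm_square_le_const[OF ab])
    show "(\<lambda>x. c + (\<integral>\<theta>. g \<theta> \<partial>lebesgue_on {a..x})) \<in> L2 a b"
      using continuous_primitive[OF L2_integrable[OF g]] by (rule continuous_L2)
    fix x assume x: "a \<le> x" "x \<le> b"
    show "(norm (c + (\<integral>\<theta>. g \<theta> \<partial>lebesgue_on {a..x})))\<^sup>2 \<le> 2 * (norm c)\<^sup>2 + 2 * ((b - a) * (L2_norm a b g)\<^sup>2)"
      using norm_add_square_le[of c "\<integral>\<theta>. g \<theta> \<partial>lebesgue_on {a..x}"] norm_integral_square_le[OF x g] by linarith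
  qed
  then show ?thesis by (simp add: power2_eq_square algebra_simps)
qed

text \<open>Both moments of \<open>v\<close> are bounded by its norm: the second one directly by Cauchy-Schwarz, the first one as
  the integral of the indefinite integral of \<open>v\<close>.\<close>

lemma linear_T1_moments_bounded:
  fixes L :: "(real ^ 'n) \<times> (real ^ 'n) \<Rightarrow> 'c::euclidean_space"
  assumes ab: "a \<le> b" and "linear L"
  obtains C where "0 \<le> C" "\<And>v. v \<in> L2 a b \<Longrightarrow>
    (norm (L (\<integral>\<theta>. (b - \<theta>) *\<^sub>R v \<theta> \<partial>lebesgue_on {a..b}, \<integral>\<theta>. v \<theta> \<partial>lebesgue_on {a..b})))\<^sup>2 \<le> C * (L2_norm a b v)\<^sup>2"
proof -
  obtain K where K: "\<And>p. norm (L p) \<le> K * norm p"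
    using linear_bounded[OF assms(2)] by blast
  show ?thesis
  proof (rule that[of "K\<^sup>2 * (2 * (b - a) ^ 3 + (b - a))"])
    show "0 \<le> K\<^sup>2 * (2 * (b - a) ^ 3 + (b - a))"
      using ab by simp
    fix v :: "real \<Rightarrow> real ^ 'n" assume v: "v \<in> L2 a b"
    let ?J = "\<integral>\<theta>. (b - \<theta>) *\<^sub>R v \<theta> \<partial>lebesgue_on {a..b}" and ?I = "\<integral>\<theta>. v \<theta> \<partial>lebesgue_on {a..b}"
    let ?P = "\<lambda>x. \<integral>\<theta>. v \<theta> \<partial>lebesgue_on {a..x}"
    have PL2: "?P \<in> L2 a b"
      using indefinite_integral_continuous_real[OF L2_integrable[OF v]] by (rule continuous_L2)
    have "(norm ?J)\<^sup>2 \<le> (b - a) * (L2_norm a b ?P)\<^sup>2"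
      using norm_integral_square_le[OF ab order_refl PL2] integral_integral_eq[OF L2_integrable[OF v] ab order_refl]
      by simp
    also have "\<dots> \<le> (b - a) * (2 * (b - a)\<^sup>2 * (L2_norm a b v)\<^sup>2)"
      using L2_norm_primitive_square_le[OF ab v, of 0] ab by (intro mult_left_mono) auto
    finally have "(norm ?J)\<^sup>2 \<le> 2 * (b - a) ^ 3 * (L2_norm a b v)\<^sup>2"
      by (simp add: power2_eq_square power3_eq_cube algebra_simps)
    moreover have "(norm ?I)\<^sup>2 \<le> (b - a) * (L2_norm a b v)\<^sup>2"
      using norm_integral_square_le[OF ab order_refl v] .
    ultimately have "(norm (?J, ?I))\<^sup>2 \<le> (2 * (b - a) ^ 3 + (b - a)) * (L2_norm a b v)\<^sup>2"
      by (simp add: norm_Pair distrib_right)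
    then have "K\<^sup>2 * (norm (?J, ?I))\<^sup>2 \<le> K\<^sup>2 * ((2 * (b - a) ^ 3 + (b - a)) * (L2_norm a b v)\<^sup>2)"
      by (rule mult_left_mono) simp
    moreover have "(norm (L (?J, ?I)))\<^sup>2 \<le> K\<^sup>2 * (norm (?J, ?I))\<^sup>2"
      using power_mono[OF K norm_ge_zero, of _ 2] by (simp add: power_mult_distrib)
    ultimately show "(norm (L (?J, ?I)))\<^sup>2 \<le> K\<^sup>2 * (2 * (b - a) ^ 3 + (b - a)) * (L2_norm a b v)\<^sup>2"
      by (simp add: mult.assoc)
  qed
qed

text \<open>\<open>T1_op a b B v\<close> is a constant plus the integral of its derivative, which in turn is a constant plus the
  integral of \<open>v\<close>; the constants are bounded linear functions of the moments of \<open>v\<close>.\<close>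

lemma T1_op_bounded:
  fixes B :: "real ^ ('n + 'n + 'n + 'n) ^ ('n::finite + 'n)"
  assumes ab: "a < b"
  obtains C where "0 \<le> C" "\<And>v. v \<in> L2 a b \<Longrightarrow> (H2_norm a b (T1_op a b B v))\<^sup>2 \<le> C * (L2_norm a b v)\<^sup>2"
proof -
  have ab': "a \<le> b" using ab by simp
  have lin: "linear (\<lambda>p. top_block (boundary_coeffs a b B p))" "linear (\<lambda>p. bot_block (boundary_coeffs a b B p))"
    using linear_compose[OF linear_boundary_coeffs linear_top_block, of a b B]
      linear_compose[OF linear_boundary_coeffs linear_bot_block, of a b B] by (simp_all add: comp_def)
  obtain C1 where C1: "0 \<le> C1"
    "\<And>v. v \<in> L2 a b \<Longrightarrow> (norm (top_block (T1_coeffs a b B v)))\<^sup>2 \<le> C1 * (L2_norm a b v)\<^sup>2"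
    using linear_T1_moments_bounded[OF ab' lin(1)] unfolding T1_coeffs_def by blast
  obtain C2 where C2: "0 \<le> C2"
    "\<And>v. v \<in> L2 a b \<Longrightarrow> (norm (bot_block (T1_coeffs a b B v)))\<^sup>2 \<le> C2 * (L2_norm a b v)\<^sup>2"
    using linear_T1_moments_bounded[OF ab' lin(2)] unfolding T1_coeffs_def by blast
  define D where "D = 2 * (b - a) * C2 + 2 * (b - a)\<^sup>2"
  define E where "E = 2 * (b - a) * C1 + 2 * (b - a)\<^sup>2 * D"
  have "0 \<le> D" "0 \<le> E" using ab C1(1) C2(1) by (simp_all add: D_def E_def)
  show ?thesis
  proof (rule that[of "E + D + 1"])
    show "0 \<le> E + D + 1" using \<open>0 \<le> D\<close> \<open>0 \<le> E\<close> by simp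
    fix v :: "real \<Rightarrow> real ^ 'n" assume v: "v \<in> L2 a b"
    let ?N = "(L2_norm a b v)\<^sup>2"
    have dx: "(L2_norm a b (T1_dx a b B v))\<^sup>2 \<le> D * ?N"
    proof -
      have "(L2_norm a b (T1_dx a b B v))\<^sup>2
          \<le> 2 * (b - a) * (norm (bot_block (T1_coeffs a b B v)))\<^sup>2 + 2 * (b - a)\<^sup>2 * ?N"
        unfolding T1_dx_def[abs_def] by (rule L2_norm_primitive_square_le[OF ab' v])
      also have "\<dots> \<le> 2 * (b - a) * (C2 * ?N) + 2 * (b - a)\<^sup>2 * ?N"
        using C2(2)[OF v] ab by (intro add_right_mono mult_left_mono) auto
      finally show ?thesis by (simp add: D_def algebra_simps)
    qed
    have "L2_norm a b (T1_op a b B v)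
        = L2_norm a b (\<lambda>x. top_block (T1_coeffs a b B v) + (\<integral>y. T1_dx a b B v y \<partial>lebesgue_on {a..x}))"
      using T1_op_has_weak_deriv(1)[OF ab v, of B] by (intro L2_norm_cong T1_op_ae_eq v) (simp add: has_weak_deriv_def)
    then have "(L2_norm a b (T1_op a b B v))\<^sup>2
        \<le> 2 * (b - a) * (norm (top_block (T1_coeffs a b B v)))\<^sup>2 + 2 * (b - a)\<^sup>2 * (L2_norm a b (T1_dx a b B v))\<^sup>2"
      using L2_norm_primitive_square_le[OF ab' T1_dx_L2[OF v]] by simp
    also have "\<dots> \<le> 2 * (b - a) * (C1 * ?N) + 2 * (b - a)\<^sup>2 * (D * ?N)"
      using C1(2)[OF v] dx ab by (intro add_mono mult_left_mono) auto
    finally have "(L2_norm a b (T1_op a b B v))\<^sup>2 \<le> E * ?N"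
      by (simp add: E_def algebra_simps)
    then show "(H2_norm a b (T1_op a b B v))\<^sup>2 \<le> (E + D + 1) * ?N"
      using dx H2_norm_square[OF ab T1_op_has_weak_deriv[OF ab v, of B]] by (simp add: algebra_simps)
  qed
qed

section \<open>Solutions\<close>

text \<open>The numerator of the difference quotient that defines the Frechet derivative.\<close>

definition remainder :: "(real \<Rightarrow> real \<Rightarrow> 'c::real_vector) \<Rightarrow> (real \<Rightarrow> 'c) \<Rightarrow> real \<Rightarrow> real \<Rightarrow> real \<Rightarrow> 'c" where
  "remainder f d t s x = f s x - f t x - (s - t) *\<^sub>R d x"

lemma remainder_eq_linear_combination:
  "remainder f d t s = (\<lambda>x. f s x + (-1) *\<^sub>R f t x + (- (s - t)) *\<^sub>R d x)"
  by (simp add: fun_eq_iff remainder_def algebra_simps)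

lemma has_frechet_deriv_iff:
  "has_frechet_deriv X N f d t \<longleftrightarrow>
    d \<in> X \<and> ((\<lambda>s. N (remainder f d t s) / \<bar>s - t\<bar>) \<longlongrightarrow> 0) (at t within {0..})"
  by (simp add: has_frechet_deriv_def remainder_def[abs_def])

text \<open>Differentiability passes along every map that takes remainders to remainders and is bounded on
  them. Squares of norms appear since that is how the bounds are available.\<close>

lemma has_frechet_deriv_transfer:
  assumes deriv: "has_frechet_deriv X N f d t" and "d' \<in> X'" and C: "0 \<le> C"
    and le: "\<And>s. 0 \<le> s \<Longrightarrow> (N' (remainder f' d' t s))\<^sup>2 \<le> C * (N (remainder f d t s))\<^sup>2"
    and nonneg: "\<And>g. 0 \<le> N' g" "\<And>g. 0 \<le> N g"
  shows "has_frechet_deriv X' N' f' d' t"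
proof -
  have lim: "((\<lambda>s. sqrt C * (N (remainder f d t s) / \<bar>s - t\<bar>)) \<longlongrightarrow> 0) (at t within {0..})"
    using deriv tendsto_mult_left[of "\<lambda>s. N (remainder f d t s) / \<bar>s - t\<bar>" 0 _ "sqrt C"]
    by (simp add: has_frechet_deriv_iff)
  have "((\<lambda>s. N' (remainder f' d' t s) / \<bar>s - t\<bar>) \<longlongrightarrow> 0) (at t within {0..})"
  proof (rule tendsto_sandwich[OF _ _ tendsto_const lim])
    show "\<forall>\<^sub>F s in at t within {0..}. 0 \<le> N' (remainder f' d' t s) / \<bar>s - t\<bar>"
      using nonneg by simp
    have "N' (remainder f' d' t s) / \<bar>s - t\<bar> \<le> sqrt C * (N (remainder f d t s) / \<bar>s - t\<bar>)" if "0 \<le> s" for s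
    proof -
      have "N' (remainder f' d' t s) \<le> sqrt (C * (N (remainder f d t s))\<^sup>2)"
        using le[OF that] by (rule real_le_rsqrt)
      also have "\<dots> = sqrt C * N (remainder f d t s)"
        using nonneg by (simp add: real_sqrt_mult)
      finally show ?thesis by (simp add: divide_right_mono)
    qed
    then show "\<forall>\<^sub>F s in at t within {0..}. N' (remainder f' d' t s) / \<bar>s - t\<bar> \<le> sqrt C * (N (remainder f d t s) / \<bar>s - t\<bar>)"
      by (simp add: eventually_at_filter)
  qed
  then show ?thesis
    using assms(2) by (simp add: has_frechet_deriv_iff)
qed

lemma remainder_L2:
  assumes "f s \<in> L2 a b" "f t \<in> L2 a b" "d \<in> L2 a b"
  shows "remainder f d t s \<in> L2 a b"
  using assms unfolding remainder_def[abs_def] by (intro L2_diff L2_scaleR)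

lemma remainder_ae_eq:
  assumes "ae_eq a b (f s) (f' s)" "ae_eq a b (f t) (f' t)" "ae_eq a b d d'"
  shows "ae_eq a b (remainder f d t s) (remainder f' d' t s)"
  using assms unfolding ae_eq_def remainder_def by eventually_elim simp

lemma remainder_has_weak_deriv:
  assumes "a < b" "has_weak_deriv a b (f s) (g s)" "has_weak_deriv a b (f t) (g t)" "has_weak_deriv a b d e"
  shows "has_weak_deriv a b (remainder f d t s) (remainder g e t s)"
  unfolding remainder_eq_linear_combination using assms by (intro has_weak_deriv_add_scaleR)

lemma remainder_H2:
  assumes "a < b" "u s \<in> H2 a b" "u t \<in> H2 a b" "d \<in> H2 a b"
  shows "remainder u d t s \<in> H2 a b"
    "ae_eq a b (dx a b (dx a b (remainder u d t s))) (remainder (\<lambda>t. dx a b (dx a b (u t))) (dx a b (dx a b d)) t s)"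
proof -
  have wd: "has_weak_deriv a b (remainder u d t s) (remainder (\<lambda>t. dx a b (u t)) (dx a b d) t s)"
    "has_weak_deriv a b (remainder (\<lambda>t. dx a b (u t)) (dx a b d) t s)
      (remainder (\<lambda>t. dx a b (dx a b (u t))) (dx a b (dx a b d)) t s)"
    using assms H2_has_weak_deriv_dx[OF assms(1)] by (auto intro!: remainder_has_weak_deriv)
  show "remainder u d t s \<in> H2 a b"
    using wd by (rule H2_I)
  show "ae_eq a b (dx a b (dx a b (remainder u d t s))) (remainder (\<lambda>t. dx a b (dx a b (u t))) (dx a b (dx a b d)) t s)"
    using dx_dx_ae_eq[OF assms(1) wd] .
qed

lemma remainder_T1_op:
  assumes "v s \<in> L2 a b" "v t \<in> L2 a b" "w \<in> L2 a b"
  shows "ae_eq a b (T1_op a b B (remainder v w t s)) (remainder (\<lambda>t. T1_op a b B (v t)) (T1_op a b B w) t s)"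
proof (rule ae_eqI)
  fix x assume x: "a \<le> x" "x \<le> b"
  have "(\<lambda>x. v s x + (-1) *\<^sub>R v t x) \<in> L2 a b"
    using assms by (intro L2_add L2_scaleR)
  from T1_op_add_scaleR[OF this assms(3) x, of B "- (s - t)"] T1_op_add_scaleR[OF assms(1,2) x, of B "-1"]
  show "T1_op a b B (remainder v w t s) x = remainder (\<lambda>t. T1_op a b B (v t)) (T1_op a b B w) t s x"
    unfolding remainder_eq_linear_combination by simp
qed

lemma T1_op_frechet_deriv:
  fixes B :: "real ^ ('n + 'n + 'n + 'n) ^ ('n::finite + 'n)"
  assumes ab: "a < b" and v: "\<And>t. 0 \<le> t \<Longrightarrow> v t \<in> L2 a b" and t: "0 \<le> t"
    and deriv: "has_frechet_deriv (L2 a b) (L2_norm a b) v w t"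
  shows "has_frechet_deriv (H2 a b) (H2_norm a b) (\<lambda>t. T1_op a b B (v t)) (T1_op a b B w) t"
proof -
  obtain C where C: "0 \<le> C" "\<And>v. v \<in> L2 a b \<Longrightarrow> (H2_norm a b (T1_op a b B v))\<^sup>2 \<le> C * (L2_norm a b v)\<^sup>2"
    using T1_op_bounded[OF ab] by blast
  have w: "w \<in> L2 a b" using deriv by (simp add: has_frechet_deriv_iff)
  have H2: "T1_op a b B f \<in> H2 a b" if "f \<in> L2 a b" for f
    using T1_op_has_weak_deriv[OF ab that] by (rule H2_I)
  show ?thesis
  proof (rule has_frechet_deriv_transfer[OF deriv H2[OF w] C(1)])
    fix s :: real assume "0 \<le> s"
    then have r: "remainder v w t s \<in> L2 a b"
      using v t w by (intro remainder_L2)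
    have "H2_norm a b (remainder (\<lambda>t. T1_op a b B (v t)) (T1_op a b B w) t s) = H2_norm a b (T1_op a b B (remainder v w t s))"
      using remainder_T1_op[OF v[OF \<open>0 \<le> s\<close>] v[OF t] w, of B] H2[OF r] by (intro H2_norm_cong[symmetric] ab)
    then show "(H2_norm a b (remainder (\<lambda>t. T1_op a b B (v t)) (T1_op a b B w) t s))\<^sup>2 \<le> C * (L2_norm a b (remainder v w t s))\<^sup>2"
      using C(2)[OF r] by simp
  qed simp_all
qed

lemma dx_dx_frechet_deriv:
  assumes ab: "a < b" and u: "\<And>t. 0 \<le> t \<Longrightarrow> u t \<in> H2 a b" and t: "0 \<le> t"
    and deriv: "has_frechet_deriv (H2 a b) (H2_norm a b) u d t"
  shows "has_frechet_deriv (L2 a b) (L2_norm a b) (\<lambda>t. dx a b (dx a b (u t))) (dx a b (dx a b d)) t"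
proof -
  have d: "d \<in> H2 a b" using deriv by (simp add: has_frechet_deriv_iff)
  show ?thesis
  proof (rule has_frechet_deriv_transfer[OF deriv H2_L2(3)[OF ab d], of 1])
    fix s :: real assume s: "0 \<le> s"
    note r = remainder_H2[where u = u and s = s and t = t, OF ab u[OF s] u[OF t] d]
    show "(L2_norm a b (remainder (\<lambda>t. dx a b (dx a b (u t))) (dx a b (dx a b d)) t s))\<^sup>2
        \<le> 1 * (H2_norm a b (remainder u d t s))\<^sup>2"
      using L2_norm_cong[OF r(2) H2_L2(3)[OF ab r(1)]] H2_norm_square[OF ab H2_has_weak_deriv_dx[OF ab r(1)]] by simp
  qed simp_all
qed

text \<open>The derivative of a curve in \<open>X_B\<close> stays in the range of \<open>T1_op\<close>. Let \<open>e\<close> be the value of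
  \<open>E = T1_op a b B \<circ> \<partial>\<^sub>x\<^sup>2 - id\<close> at the derivative \<open>d\<close>. As \<open>E\<close> vanishes at \<open>u s\<close> and \<open>u t\<close>, it maps the
  remainder to \<open>- (s - t) e\<close>; as it is bounded from \<open>H\<^sub>2\<close> to \<open>L2\<close>, the norm of \<open>e\<close> is at most a multiple
  of a quantity that tends to zero.\<close>

lemma frechet_deriv_in_range_T1_op:
  fixes B :: "real ^ ('n + 'n + 'n + 'n) ^ ('n::finite + 'n)"
  assumes ab: "a < b" and inv: "invertible (B ** Hmat a b)"
    and u: "\<And>t. 0 \<le> t \<Longrightarrow> u t \<in> X_B a b B" and t: "0 \<le> t"
    and deriv: "has_frechet_deriv (H2 a b) (H2_norm a b) u d t"
  shows "ae_eq a b (T1_op a b B (dx a b (dx a b d))) d"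
proof -
  obtain C where C: "0 \<le> C" "\<And>v. v \<in> L2 a b \<Longrightarrow> (H2_norm a b (T1_op a b B v))\<^sup>2 \<le> C * (L2_norm a b v)\<^sup>2"
    using T1_op_bounded[OF ab] by blast
  have d: "d \<in> H2 a b" and lim: "((\<lambda>s. H2_norm a b (remainder u d t s) / \<bar>s - t\<bar>) \<longlongrightarrow> 0) (at t within {0..})"
    using deriv by (simp_all add: has_frechet_deriv_iff)
  have uH2: "u t \<in> H2 a b" if "0 \<le> t" for t
    using u[OF that] by (simp add: X_B_def)
  have T1_L2: "T1_op a b B v \<in> L2 a b" if "v \<in> L2 a b" for v
    using T1_op_has_weak_deriv(1)[OF ab that] by (simp add: has_weak_deriv_def)
  let ?D = "\<lambda>f. dx a b (dx a b f)"
  define e where "e = (\<lambda>x. T1_op a b B (?D d) x - d x)"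
  have e: "e \<in> L2 a b"
    unfolding e_def using H2_L2[OF ab d] by (intro L2_diff T1_L2)
  have bound: "(L2_norm a b e)\<^sup>2 \<le> (2 * C + 2) * (H2_norm a b (remainder u d t s) / \<bar>s - t\<bar>)\<^sup>2"
    if s: "0 \<le> s" "s \<noteq> t" for s
  proof -
    let ?r = "remainder u d t s"
    note r = remainder_H2[where u = u and s = s and t = t, OF ab uH2[OF s(1)] uH2[OF t] d]
    note DL2 = H2_L2(3)[OF ab uH2[OF s(1)]] H2_L2(3)[OF ab uH2[OF t]] H2_L2(3)[OF ab d]
    have Dr: "?D ?r \<in> L2 a b" using H2_L2(3)[OF ab r(1)] .
    have "ae_eq a b (T1_op a b B (?D ?r)) (T1_op a b B (remainder (\<lambda>t. ?D (u t)) (?D d) t s))"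
      using DL2 by (intro T1_op_ae_cong[OF r(2) Dr] remainder_L2)
    from ae_eq_trans[OF this remainder_T1_op[where v = "\<lambda>t. ?D (u t)", OF DL2]]
    have "ae_eq a b (\<lambda>x. (- (s - t)) *\<^sub>R e x) (\<lambda>x. T1_op a b B (?D ?r) x - ?r x)"
      using T1_op_dx_dx[OF ab inv u[OF s(1)]] T1_op_dx_dx[OF ab inv u[OF t]]
      unfolding ae_eq_def by eventually_elim (simp add: e_def remainder_def algebra_simps)
    then have "\<bar>s - t\<bar> * L2_norm a b e = L2_norm a b (\<lambda>x. T1_op a b B (?D ?r) x - ?r x)"
      using L2_norm_cong[OF _ L2_scaleR[OF e]] L2_norm_scaleR[of a b "- (s - t)" e] by (simp add: abs_minus_commute)
    then have "(\<bar>s - t\<bar> * L2_norm a b e)\<^sup>2 \<le> 2 * (L2_norm a b (T1_op a b B (?D ?r)))\<^sup>2 + 2 * (L2_norm a b ?r)\<^sup>2"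
      using L2_norm_diff_square_le[OF T1_L2[OF Dr] H2_L2(1)[OF ab r(1)]] by simp
    moreover have "(L2_norm a b (T1_op a b B (?D ?r)))\<^sup>2 \<le> C * (L2_norm a b (?D ?r))\<^sup>2"
      using C(2)[OF Dr] H2_norm_square[OF ab T1_op_has_weak_deriv[OF ab Dr, of B]]
        zero_le_power2[of "L2_norm a b (T1_dx a b B (?D ?r))"] zero_le_power2[of "L2_norm a b (?D ?r)"] by linarith
    moreover have "(L2_norm a b ?r)\<^sup>2 \<le> (H2_norm a b ?r)\<^sup>2" "(L2_norm a b (?D ?r))\<^sup>2 \<le> (H2_norm a b ?r)\<^sup>2"
      using H2_norm_square[OF ab H2_has_weak_deriv_dx[OF ab r(1)]] by simp_all
    moreover from this(2) have "C * (L2_norm a b (?D ?r))\<^sup>2 \<le> C * (H2_norm a b ?r)\<^sup>2"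
      using C(1) by (rule mult_left_mono)
    ultimately have "(\<bar>s - t\<bar> * L2_norm a b e)\<^sup>2 \<le> (2 * C + 2) * (H2_norm a b ?r)\<^sup>2"
      unfolding distrib_right by linarith
    then show ?thesis
      using s(2) by (simp add: power_mult_distrib power_divide pos_le_divide_eq mult.commute)
  qed
  have "((\<lambda>s. (2 * C + 2) * (H2_norm a b (remainder u d t s) / \<bar>s - t\<bar>)\<^sup>2) \<longlongrightarrow> (2 * C + 2) * 0\<^sup>2) (at t within {0..})"
    using lim by (intro tendsto_intros)
  moreover have "\<forall>\<^sub>F s in at t within {0..}. (L2_norm a b e)\<^sup>2 \<le> (2 * C + 2) * (H2_norm a b (remainder u d t s) / \<bar>s - t\<bar>)\<^sup>2"
    using bound by (simp add: eventually_at_filter)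
  moreover have "at t within {0..} \<noteq> bot"
  proof -
    have "at_right t \<le> at t within {0..}"
      using t by (intro at_le) auto
    then show ?thesis
      using trivial_limit_at_right_real[of t] by (auto simp: bot_unique)
  qed
  ultimately have "(L2_norm a b e)\<^sup>2 \<le> (2 * C + 2) * 0\<^sup>2"
    using tendsto_lowerbound by blast
  then have "L2_norm a b e = 0" by simp
  from L2_norm_zero_imp_ae_eq[OF e this] show ?thesis
    unfolding ae_eq_def e_def by eventually_elim simp
qed

text \<open>The time derivatives correspond like the states: \<open>u\<^sub>t = T1_op a b B v\<^sub>t\<close> and \<open>v\<^sub>t = \<partial>\<^sub>x\<^sup>2 u\<^sub>t\<close>.\<close>

lemma PIE_iff_PDE:
  fixes A :: "real \<Rightarrow> real ^ ('n + 'n + 'n) ^ ('n::finite)"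
  assumes ab: "a < b" and inv: "invertible (B ** Hmat a b)"
    and v: "\<And>t. 0 \<le> t \<Longrightarrow> v t \<in> L2 a b" and v0: "v0 \<in> L2 a b"
  shows "PIE_solution a b A B p v0 v \<longleftrightarrow> PDE_solution a b A B p (T1_op a b B v0) (\<lambda>t. T1_op a b B (v t))"
proof
  let ?T = "T1_op a b B"
  have A11: "ae_eq a b (\<lambda>x. A11_op a b A B (v t) x + p t x)
      (\<lambda>x. A x *v (?T (v t) x \<triangleright> dx a b (?T (v t)) x \<triangleright> dx a b (dx a b (?T (v t))) x) + p t x)" if "0 \<le> t" for t
    using A11_op_ae_eq[OF ab v[OF that], of A B] unfolding ae_eq_def by eventually_elim simp
  have XB: "?T (v t) \<in> X_B a b B" if "0 \<le> t" for t
    using T1_op_in_X_B[OF ab inv v[OF that]] .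
  {
    assume "PIE_solution a b A B p v0 v"
    then obtain v_t where init: "ae_eq a b (v 0) v0"
      and deriv: "\<And>t. 0 \<le> t \<Longrightarrow> has_frechet_deriv (L2 a b) (L2_norm a b) v (v_t t) t"
      and eq: "\<And>t. 0 \<le> t \<Longrightarrow> ae_eq a b (?T (v_t t)) (\<lambda>x. A11_op a b A B (v t) x + p t x)"
      unfolding PIE_solution_def by blast
    show "PDE_solution a b A B p (?T v0) (\<lambda>t. ?T (v t))"
      unfolding PDE_solution_def
    proof (intro conjI exI[of _ "\<lambda>t. ?T (v_t t)"] allI impI)
      show "ae_eq a b (?T (v 0)) (?T v0)"
        using init v v0 by (intro T1_op_ae_cong) auto
      fix t :: real assume t: "0 \<le> t"
      show "?T (v t) \<in> X_B a b B" using XB[OF t] .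
      show "has_frechet_deriv (H2 a b) (H2_norm a b) (\<lambda>t. ?T (v t)) (?T (v_t t)) t"
        using T1_op_frechet_deriv[OF ab v t deriv[OF t]] .
      show "ae_eq a b (?T (v_t t))
          (\<lambda>x. A x *v (?T (v t) x \<triangleright> dx a b (?T (v t)) x \<triangleright> dx a b (dx a b (?T (v t))) x) + p t x)"
        using ae_eq_trans[OF eq[OF t] A11[OF t]] .
    qed
  next
    assume "PDE_solution a b A B p (?T v0) (\<lambda>t. ?T (v t))"
    then obtain u_t where init: "ae_eq a b (?T (v 0)) (?T v0)"
      and deriv: "\<And>t. 0 \<le> t \<Longrightarrow> has_frechet_deriv (H2 a b) (H2_norm a b) (\<lambda>t. ?T (v t)) (u_t t) t"
      and eq: "\<And>t. 0 \<le> t \<Longrightarrow> ae_eq a b (u_t t)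
          (\<lambda>x. A x *v (?T (v t) x \<triangleright> dx a b (?T (v t)) x \<triangleright> dx a b (dx a b (?T (v t))) x) + p t x)"
      unfolding PDE_solution_def by blast
    show "PIE_solution a b A B p v0 v"
      unfolding PIE_solution_def
    proof (intro conjI exI[of _ "\<lambda>t. dx a b (dx a b (u_t t))"] allI impI)
      have "ae_eq a b (v 0) (dx a b (dx a b (?T v0)))"
        using ae_eq_sym[OF dx_dx_T1_op[OF ab v[OF order_refl], of B]] dx_cong[OF ab init] by simp
      then show "ae_eq a b (v 0) v0"
        using dx_dx_T1_op[OF ab v0] by (rule ae_eq_trans)
      fix t :: real assume t: "0 \<le> t"
      show "v t \<in> L2 a b" using v[OF t] .
      have TH2: "?T (v t) \<in> H2 a b" if "0 \<le> t" for t
        using XB[OF that] by (simp add: X_B_def)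
      have d: "u_t t \<in> H2 a b" using deriv[OF t] by (simp add: has_frechet_deriv_iff)
      show "has_frechet_deriv (L2 a b) (L2_norm a b) v (dx a b (dx a b (u_t t))) t"
      proof (rule has_frechet_deriv_transfer[OF dx_dx_frechet_deriv[OF ab TH2 t deriv[OF t]], of _ _ 1])
        show "dx a b (dx a b (u_t t)) \<in> L2 a b" using H2_L2(3)[OF ab d] .
        fix s :: real assume s: "0 \<le> s"
        have "ae_eq a b (remainder v (dx a b (dx a b (u_t t))) t s)
            (remainder (\<lambda>t. dx a b (dx a b (?T (v t)))) (dx a b (dx a b (u_t t))) t s)"
          using s t v by (intro remainder_ae_eq ae_eq_sym[OF dx_dx_T1_op[OF ab]] ae_eq_refl)
        then show "(L2_norm a b (remainder v (dx a b (dx a b (u_t t))) t s))\<^sup>2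
            \<le> 1 * (L2_norm a b (remainder (\<lambda>t. dx a b (dx a b (?T (v t)))) (dx a b (dx a b (u_t t))) t s))\<^sup>2"
          using L2_norm_cong remainder_L2[where f = v, OF v[OF s] v[OF t] H2_L2(3)[OF ab d]] by fastforce
      qed simp_all
      show "ae_eq a b (?T (dx a b (dx a b (u_t t)))) (\<lambda>x. A11_op a b A B (v t) x + p t x)"
        using frechet_deriv_in_range_T1_op[OF ab inv XB t deriv[OF t]] eq[OF t] ae_eq_sym[OF A11[OF t]]
        by (blast intro: ae_eq_trans)
    qed
  }
qed

text \<open>\<open>T1_op a b B (\<partial>\<^sub>x\<^sup>2 u)\<close> agrees with \<open>u\<close> only almost everywhere, so being a solution must be shown to
  respect this equality.\<close>

lemma PDE_solution_ae_cong:
  assumes ab: "a < b" and u: "\<And>t. 0 \<le> t \<Longrightarrow> u t \<in> X_B a b B" and u': "\<And>t. 0 \<le> t \<Longrightarrow> u' t \<in> X_B a b B"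
    and eq: "\<And>t. 0 \<le> t \<Longrightarrow> ae_eq a b (u t) (u' t)" and eq0: "ae_eq a b u0 u0'"
    and sol: "PDE_solution a b A B p u0 u"
  shows "PDE_solution a b A B p u0' u'"
proof -
  obtain u_t where init: "ae_eq a b (u 0) u0"
    and deriv: "\<And>t. 0 \<le> t \<Longrightarrow> has_frechet_deriv (H2 a b) (H2_norm a b) u (u_t t) t"
    and pde: "\<And>t. 0 \<le> t \<Longrightarrow> ae_eq a b (u_t t)
        (\<lambda>x. A x *v (u t x \<triangleright> dx a b (u t) x \<triangleright> dx a b (dx a b (u t)) x) + p t x)"
    using sol unfolding PDE_solution_def by blast
  show ?thesis
    unfolding PDE_solution_def
  proof (intro conjI exI[of _ u_t] allI impI)
    show "ae_eq a b (u' 0) u0'"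
      using ae_eq_trans[OF ae_eq_trans[OF ae_eq_sym[OF eq[OF order_refl]] init] eq0] .
    fix t :: real assume t: "0 \<le> t"
    show "u' t \<in> X_B a b B" using u'[OF t] .
    have d: "u_t t \<in> H2 a b" using deriv[OF t] by (simp add: has_frechet_deriv_iff)
    show "has_frechet_deriv (H2 a b) (H2_norm a b) u' (u_t t) t"
    proof (rule has_frechet_deriv_transfer[OF deriv[OF t] d, of 1])
      fix s :: real assume s: "0 \<le> s"
      have "remainder u (u_t t) t s \<in> H2 a b"
        using u[OF s] u[OF t] d by (intro remainder_H2 ab) (simp_all add: X_B_def)
      moreover have "ae_eq a b (remainder u (u_t t) t s) (remainder u' (u_t t) t s)"
        using eq s t by (intro remainder_ae_eq ae_eq_refl)
      ultimately show "(H2_norm a b (remainder u' (u_t t) t s))\<^sup>2 \<le> 1 * (H2_norm a b (remainder u (u_t t) t s))\<^sup>2"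
        using H2_norm_cong[OF ab] by fastforce
    qed simp_all
    show "ae_eq a b (u_t t) (\<lambda>x. A x *v (u' t x \<triangleright> dx a b (u' t) x \<triangleright> dx a b (dx a b (u' t)) x) + p t x)"
      using pde[OF t] eq[OF t] unfolding dx_cong[OF ab eq[OF t]] ae_eq_def by eventually_elim simp
  qed
qed

theorem lemma5:
  fixes a b :: real
    and A :: "real \<Rightarrow> real ^ ('n + 'n + 'n) ^ ('n::finite)"
    and B :: "real ^ ('n + 'n + 'n + 'n) ^ ('n + 'n)"
    and p :: "real \<Rightarrow> real \<Rightarrow> real ^ 'n"
  assumes "a < b"
    and "A \<in> Linf a b"
    and "invertible (B ** Hmat a b)"
    and "\<And>t. t \<ge> 0 \<Longrightarrow> p t \<in> L2 a b"
  shows "(\<forall>v v0. (\<forall>t\<ge>0. v t \<in> L2 a b) \<and> v0 \<in> L2 a b \<longrightarrow>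
            (PIE_solution a b A B p v0 v \<longleftrightarrow>
             PDE_solution a b A B p (T1_op a b B v0) (\<lambda>t. T1_op a b B (v t))))
       \<and> (\<forall>u u0. (\<forall>t\<ge>0. u t \<in> X_B a b B) \<and> u0 \<in> X_B a b B \<longrightarrow>
            (PDE_solution a b A B p u0 u \<longleftrightarrow>
             PIE_solution a b A B p (dx a b (dx a b u0)) (\<lambda>t. dx a b (dx a b (u t)))))"
proof (intro conjI allI impI)
  fix v :: "real \<Rightarrow> real \<Rightarrow> real ^ 'n" and v0 :: "real \<Rightarrow> real ^ 'n"
  assume "(\<forall>t\<ge>0. v t \<in> L2 a b) \<and> v0 \<in> L2 a b"
  then show "PIE_solution a b A B p v0 v \<longleftrightarrow>
      PDE_solution a b A B p (T1_op a b B v0) (\<lambda>t. T1_op a b B (v t))"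
    using assms(1,3) by (intro PIE_iff_PDE) auto
next
  fix u :: "real \<Rightarrow> real \<Rightarrow> real ^ 'n" and u0 :: "real \<Rightarrow> real ^ 'n"
  assume asm: "(\<forall>t\<ge>0. u t \<in> X_B a b B) \<and> u0 \<in> X_B a b B"
  let ?D = "\<lambda>u. dx a b (dx a b u)"
  have L2: "?D w \<in> L2 a b" if "w \<in> X_B a b B" for w
    using H2_L2(3)[OF assms(1), of w] that by (simp add: X_B_def)
  have XB: "T1_op a b B (?D (u t)) \<in> X_B a b B" if "0 \<le> t" for t
    using T1_op_in_X_B[OF assms(1,3) L2] asm that by blast
  have inv: "ae_eq a b (T1_op a b B (?D w)) w" if "w \<in> X_B a b B" for w
    using T1_op_dx_dx[OF assms(1,3) that] .
  have "PDE_solution a b A B p u0 u \<longleftrightarrow> PDE_solution a b A B p (T1_op a b B (?D u0)) (\<lambda>t. T1_op a b B (?D (u t)))"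
  proof
    assume "PDE_solution a b A B p u0 u"
    then show "PDE_solution a b A B p (T1_op a b B (?D u0)) (\<lambda>t. T1_op a b B (?D (u t)))"
      using asm XB by (elim PDE_solution_ae_cong[OF assms(1), rotated -1]) (auto intro: ae_eq_sym[OF inv])
  next
    assume "PDE_solution a b A B p (T1_op a b B (?D u0)) (\<lambda>t. T1_op a b B (?D (u t)))"
    then show "PDE_solution a b A B p u0 u"
      using asm XB by (elim PDE_solution_ae_cong[OF assms(1), rotated -1]) (auto intro: inv)
  qed
  also have "\<dots> \<longleftrightarrow> PIE_solution a b A B p (?D u0) (\<lambda>t. ?D (u t))"
    using asm L2 assms(1,3) by (intro PIE_iff_PDE[symmetric]) auto
  finally show "PDE_solution a b A B p u0 u \<longleftrightarrow> PIE_solution a b A B p (?D u0) (\<lambda>t. ?D (u t))" .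
qed

end
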